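(* Let $x$ be an indeterminate. For all positive integers $n$, $$D_2(n;x):=\det_{0\le i,j\le n-1}\left(2^i\binom {x+i+2j+1}{2j+1}+\binom {x-i+2j+1}{2j+1}\right)$$ satisfies $$D_2(n;x)=2^{\binom n2+1}\prod _{i=0} ^{n-1}\frac {i!} {(2i+1)!}\prod _{i=0} ^{\lfloor n/2\rfloor}(x+4i+1)_{n-2i}\prod _{i=0} ^{\lfloor (n-1)/2\rfloor}(x-2i+3n)_{n-2i-1}$$ and $$D_2(n;x)=2\prod_{i=1}^n \frac{2^{2 i-2} \, \Gamma(i) \, \Gamma(2i+x) \,\Gamma(4i+x-1) \, \Gamma\bigl(\frac{3 i+x-2}{2}\bigr)}{\Gamma(2i) \, \Gamma(3i+x) \, \Gamma(3i+x-2) \,\Gamma\bigl(\frac{i+x}{2}\bigr)}.$$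
   Context: The binomial coefficient is $\binom{\alpha}{p}=\frac{\alpha(\alpha-1)\cdots(\alpha-p+1)}{p!}$ if $p\ge 0$ is an integer, and $0$ if $p<0$. The Pochhammer symbol is $(\alpha)_p=\alpha(\alpha+1)\cdots(\alpha+p-1)$ for $p\ge1$ and $(\alpha)_0=1$. The quotients of Gamma functions are understood as the rational functions of $x$ obtained by simplifying using $\Gamma(z+1)=z\Gamma(z)$. *)

theory Defs
  imports
    "HOL-Computational_Algebra.Polynomial_Factorial"
    "Jordan_Normal_Form.Determinant"
begin

definition indet :: "rat poly fract" where
  "indet = to_fract [:0, 1:]"

definition D2 :: "nat \<Rightarrow> 'a::field_char_0 \<Rightarrow> 'a" where
  "D2 n x = det (mat n n (\<lambda>(i, j).
     2 ^ i * ((x + of_nat i + 2 * of_nat j + 1) gchoose (2 * j + 1))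
     + ((x - of_nat i + 2 * of_nat j + 1) gchoose (2 * j + 1))))"

(* Gamma_quot a b is the quotient Gamma(a) / Gamma(b), for a and b differing by an integer,
   simplified by means of Gamma(z + 1) = z * Gamma(z); it is left unspecified for other
   arguments. The three lemmas below justify the definition. *)
definition Gamma_quot :: "'a::field_char_0 \<Rightarrow> 'a \<Rightarrow> 'a" where
  "Gamma_quot a b =
     (if \<exists>m::nat. a = b + of_nat m then pochhammer b (THE m. a = b + of_nat m)
      else if \<exists>m::nat. b = a + of_nat m then 1 / pochhammer a (THE m. b = a + of_nat m)
      else undefined)"

lemma Gamma_quot_plus: "Gamma_quot (b + of_nat m) b = pochhammer b m"
proof -
  have "(THE k. b + of_nat m = b + of_nat k) = m"
    by (rule the_equality) auto
  then show ?thesis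
    unfolding Gamma_quot_def by auto
qed

lemma Gamma_quot_minus: "Gamma_quot a (a + of_nat m) = 1 / pochhammer a m"
proof (cases "m = 0")
  case True
  then show ?thesis using Gamma_quot_plus[of a 0] by simp
next
  case False
  have "\<not> (\<exists>k::nat. a = a + of_nat m + of_nat k)"
  proof
    assume "\<exists>k::nat. a = a + of_nat m + of_nat k"
    then obtain k :: nat where "a = a + of_nat m + of_nat k" by blast
    then have "(of_nat (m + k) :: 'a) = 0" by (simp add: algebra_simps)
    with False show False by (simp only: of_nat_eq_0_iff)
  qed
  moreover have "(THE k. a + of_nat m = a + of_nat k) = m"
    by (rule the_equality) auto
  ultimately show ?thesis
    unfolding Gamma_quot_def by auto
qed

lemma Gamma_quot_functional_equation:
  fixes G :: "'a::field_char_0 \<Rightarrow> 'a"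
  assumes G: "\<And>z. (\<forall>k::nat. z \<noteq> - of_nat k) \<Longrightarrow> G (z + 1) = z * G z \<and> G z \<noteq> 0"
    and a: "\<forall>k::nat. a \<noteq> - of_nat k" and b: "\<forall>k::nat. b \<noteq> - of_nat k"
    and int: "a - b \<in> \<int>"
  shows "Gamma_quot a b = G a / G b"
proof -
  have step: "G (z + of_nat m) = pochhammer z m * G z"
    if z: "\<forall>k::nat. z \<noteq> - of_nat k" for z and m :: nat
  proof (induction m)
    case 0
    then show ?case by simp
  next
    case (Suc m)
    have "z + of_nat m \<noteq> - of_nat k" for k :: nat
    proof
      assume "z + of_nat m = - of_nat k"
      then have "z = - of_nat (m + k)" by (simp add: eq_neg_iff_add_eq_0 algebra_simps)
      with z show False by blast
    qed
    then have "G (z + of_nat m + 1) = (z + of_nat m) * G (z + of_nat m)"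
      using G by blast
    with Suc show ?case by (simp add: pochhammer_Suc algebra_simps)
  qed
  from int obtain i :: int where i: "a - b = of_int i" by (elim Ints_cases)
  show ?thesis
  proof (cases "i \<ge> 0")
    case True
    then obtain m where "i = int m" by (metis nat_0_le)
    with i have "a = b + of_nat m" by (simp add: algebra_simps)
    moreover have "G b \<noteq> 0" using G b by blast
    ultimately show ?thesis using step[OF b, of m] by (simp add: Gamma_quot_plus)
  next
    case False
    then obtain m where "i = - int m" by (metis add.inverse_inverse linorder_le_cases neg_0_le_iff_le nonneg_int_cases)
    with i have "b = a + of_nat m" by (simp add: algebra_simps)
    moreover have "G a \<noteq> 0" using G a by blast
    ultimately show ?thesis using step[OF a, of m] by (simp add: Gamma_quot_minus)
  qed
qed

end

theory Submission
  imports Defs "HOL-Computational_Algebra.Formal_Power_Series"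
    "HOL-Computational_Algebra.Field_as_Ring"
begin

text \<open>
  Put \<open>u = 1 - t\<close> and \<open>G = t (1 + t) / (1 - t)\<close>. The entries of the matrix are the coefficients of
  \<open>t^(2j+1)\<close> in \<open>u^(-x-1) ((2/u)^i + u^i)\<close>. Since \<open>u + 2/u = G + 3\<close>, row operations replace the
  rows by those of \<open>u^(-x-1) G^i\<close>, at the cost of a factor 2. The determinant of the new matrix is a
  polynomial in \<open>x\<close>, and its zeros are found from the dihedral group of order 8 generated by the
  involutions \<open>t \<rightarrow> -t\<close> and \<open>u \<rightarrow> 2/u\<close> (the latter fixes \<open>G\<close>). At \<open>x = -m\<close> the invariant forms of
  this group, products of powers of \<open>1 + t^2\<close> and \<open>t (1 - t^2)\<close>, give the left kernel vectors
  \<open>G^i (1 + G)^(m-1-2i)\<close> with \<open>i\<close> even and \<open>2i + 1 \<le> m \<le> n + i\<close>. Dually, the even Laurent series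
  \<open>(1 - 6 t^2 + t^4) (t (1 - t^2))^(-2l) (1 + t^2)^(4l-m-2)\<close> with \<open>2l + n \<le> m \<le> 4l - 2\<close> give right
  kernel vectors, because after multiplication by \<open>u^(m-1) G^i dt\<close> they become differentials
  \<open>(1 - G) (1 + G)^(4l-m-2) G^(i-2l) dG\<close> without residue. Counted with multiplicity these are
  \<open>n (n + 1) / 2\<close> zeros, which is also the degree, and the leading coefficient is
  \<open>det (1 / (2j + 1 - i)!)\<close>. The second formula follows from the first by induction on \<open>n\<close>.
\<close>

no_notation vec_index (infixl "$" 100)
unbundle fps_syntax

section \<open>Even power series and vanishing residues\<close>

definition even_fps :: "'a::comm_ring_1 fps \<Rightarrow> bool" where
  "even_fps f \<longleftrightarrow> (\<forall>k. odd k \<longrightarrow> f $ k = 0)"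

lemma even_fpsD: "even_fps f \<Longrightarrow> odd k \<Longrightarrow> f $ k = 0"
  by (simp add: even_fps_def)

lemma even_fps_1 [simp]: "even_fps 1"
  by (auto simp: even_fps_def fps_one_nth)

lemma even_fps_add: "even_fps f \<Longrightarrow> even_fps g \<Longrightarrow> even_fps (f + g)"
  and even_fps_diff: "even_fps f \<Longrightarrow> even_fps g \<Longrightarrow> even_fps (f - g)"
  by (auto simp: even_fps_def)

lemma even_fps_mult: "even_fps f \<Longrightarrow> even_fps g \<Longrightarrow> even_fps (f * g)"
  unfolding even_fps_def fps_mult_nth by (intro allI impI sum.neutral ballI) (metis add_diff_inverse_nat atLeastAtMost_iff even_add mult_zero_left mult_zero_right not_le)

lemma even_fps_power: "even_fps f \<Longrightarrow> even_fps (f ^ k)"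
  by (induction k) (auto intro: even_fps_mult)

lemma even_fps_X_power: "even k \<Longrightarrow> even_fps (fps_X ^ k)"
  by (auto simp: even_fps_def fps_X_power_nth)

lemma even_fps_numeral [simp]: "even_fps (numeral k)"
  by (auto simp: even_fps_def fps_numeral_nth)

lemma even_fps_inverse:
  fixes f :: "'a::field fps"
  assumes "even_fps f" "f $ 0 \<noteq> 0"
  shows "even_fps (inverse f)"
proof -
  have inv: "f * inverse f = 1"
    using assms by (simp add: inverse_mult_eq_1')
  have "odd k \<longrightarrow> inverse f $ k = 0" for k
  proof (induction k rule: less_induct)
    case (less k)
    show ?case
    proof
      assume odd: "odd k"
      have "0 = (f * inverse f) $ k"
        using odd unfolding inv by (auto simp: fps_one_nth elim: oddE)
      also have "\<dots> = (\<Sum>i=0..k. f $ i * inverse f $ (k - i))"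
        by (simp add: fps_mult_nth)
      \<comment> \<open>For \<open>i > 0\<close>, either \<open>i\<close> is odd and
        \<open>f $ i = 0\<close>, or \<open>k - i\<close> is odd and smaller than \<open>k\<close>,
        so that the induction hypothesis applies.\<close>
      also have "\<dots> = (\<Sum>i=0..k. if i = 0 then f $ 0 * inverse f $ k else 0)"
      proof (rule sum.cong)
        fix i assume i: "i \<in> {0..k}"
        show "f $ i * inverse f $ (k - i) = (if i = 0 then f $ 0 * inverse f $ k else 0)"
        proof (cases "odd i \<or> i = 0")
          case True
          then show ?thesis using assms(1) by (auto simp: even_fps_def)
        next
          case False
          then have "k - i < k" "odd (k - i)" using odd i by auto
          then show ?thesis using less False by simp
        qed
      qed simp
      finally show "inverse f $ k = 0" using assms(2) by simp
    qed
  qed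
  then show ?thesis by (simp add: even_fps_def)
qed

text \<open>Divided by \<open>fps_X ^ (r + 1)\<close>, the series is the derivative of a multiple of
  \<open>G ^ (k - r)\<close>, where \<open>k - r < 0\<close>; so it has no residue.\<close>
lemma fps_no_residue:
  fixes H :: "'a::field_char_0 fps"
  assumes H: "H $ 0 \<noteq> 0" and k: "k < r"
  defines "G \<equiv> fps_X * H"
  shows "(G ^ k * fps_deriv G * inverse H ^ (r + 1)) $ r = 0"
proof -
  define K where "K = inverse H"
  define q where "q = r - k"
  have q: "r = k + q" "q \<ge> 1" using k by (auto simp: q_def)
  have HK: "H * K = 1" using H by (simp add: K_def inverse_mult_eq_1')
  have dHK: "fps_deriv H * K + H * fps_deriv K = 0"
    using arg_cong[OF HK, of fps_deriv] by (simp add: algebra_simps)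
  obtain p where p: "q = Suc p" using q by (cases q) auto
  have 1: "H ^ k * K ^ k = 1" using HK by (metis power_mult_distrib power_one)
  \<comment> \<open>Everything is expressed through \<open>K = 1 / H\<close>, using
    \<open>H' K = - H K'\<close>; the series becomes
    \<open>X^k (K^q - X K^(q-1) K')\<close>.\<close>
  have "G ^ k * fps_deriv G * K ^ (r + 1)
      = fps_X ^ k * ((H ^ k * K ^ k) * (H + fps_X * fps_deriv H) * K ^ (p + 2))"
    by (simp add: G_def q p power_mult_distrib power_add algebra_simps)
  also have "(H ^ k * K ^ k) * (H + fps_X * fps_deriv H) * K ^ (p + 2)
      = K ^ q * (H * K) + fps_X * K ^ p * K * (fps_deriv H * K)"
    unfolding 1 by (simp add: p algebra_simps)
  also have "\<dots> = K ^ q - fps_X * K ^ p * fps_deriv K * (H * K)"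
  proof -
    have "fps_deriv H * K = - (H * fps_deriv K)" using dHK by (simp add: eq_neg_iff_add_eq_0)
    then show ?thesis by (simp add: HK) (simp add: algebra_simps flip: HK)
  qed
  also have "\<dots> = K ^ q - fps_X * (K ^ p * fps_deriv K)" by (simp add: HK algebra_simps)
  finally have "(G ^ k * fps_deriv G * K ^ (r + 1)) $ r = (K ^ q - fps_X * (K ^ p * fps_deriv K)) $ q"
    by (simp add: q(1) fps_X_power_mult_nth)
  \<comment> \<open>Both sides are the coefficient of \<open>(K^q)'\<close> at \<open>q - 1\<close>.
    The factor \<open>of_nat q\<close> can be cancelled, since \<open>q > 0\<close> and the
    characteristic is 0.\<close>
  moreover have "of_nat q * (fps_X * (K ^ p * fps_deriv K)) $ q = of_nat q * (K ^ q) $ q"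
  proof -
    have deriv: "fps_deriv (K ^ q) = fps_const (of_nat q) * (K ^ p * fps_deriv K)"
      unfolding p fps_deriv_power by (simp add: mult_ac del: of_nat_Suc)
    have "of_nat q * (fps_X * (K ^ p * fps_deriv K)) $ q = (fps_deriv (K ^ q)) $ p"
      unfolding deriv by (simp add: p del: of_nat_Suc)
    also have "\<dots> = of_nat q * (K ^ q) $ q" unfolding fps_deriv_nth by (simp add: p)
    finally show ?thesis .
  qed
  ultimately show ?thesis using q by (simp add: K_def)
qed

section \<open>Row reduction\<close>

text \<open>Polynomials stay power series with a degree bound, so that substituting \<open>G\<close>
  is plain \<open>fps_compose\<close>.\<close>

definition fps_deg_le :: "'a::comm_ring_1 fps \<Rightarrow> nat \<Rightarrow> bool" where
  "fps_deg_le f d \<longleftrightarrow> (\<forall>k>d. f $ k = 0)"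

lemma fps_deg_le_mult:
  assumes "fps_deg_le f a" "fps_deg_le g b"
  shows "fps_deg_le (f * g) (a + b)"
  unfolding fps_deg_le_def
proof (intro allI impI)
  fix k assume k: "a + b < k"
  have "f $ i * g $ (k - i) = 0" if "i \<in> {0..k}" for i
    using assms k by (cases "a < i") (auto simp: fps_deg_le_def)
  then show "(f * g) $ k = 0" by (simp add: fps_mult_nth)
qed

lemma fps_deg_le_power: "fps_deg_le f a \<Longrightarrow> fps_deg_le (f ^ k) (k * a)"
  by (induction k) (auto simp: fps_deg_le_def[of 1] intro: fps_deg_le_mult)

lemma fps_deg_le_linear: "fps_deg_le (1 + fps_X) 1" "fps_deg_le (1 - fps_X) 1"
  by (auto simp: fps_deg_le_def fps_X_def)

lemma fps_deg_le_X_power: "fps_deg_le (fps_X ^ k) k"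
  by (auto simp: fps_deg_le_def fps_X_power_nth)

text \<open>The coefficients of \<open>f\<close> act as a row vector on the coefficients of the
  series \<open>N * g ^ k\<close>. In this way identities between series become row operations and
  kernel vectors.\<close>

lemma fps_mult_compose_nth_of_deg_le:
  fixes f g N :: "'a::field fps"
  assumes f: "fps_deg_le f d" and d: "d < n" and g: "g $ 0 = 0"
  shows "(N * (f oo g)) $ r = (\<Sum>k<n. f $ k * (N * g ^ k) $ r)"
proof -
  have "f = (\<Sum>k<n. fps_const (f $ k) * fps_X ^ k)"
    using f d by (intro fps_ext)
      (auto simp: fps_sum_nth fps_X_power_nth fps_deg_le_def if_distrib not_less cong: if_cong)
  then have "f oo g = (\<Sum>k<n. fps_const (f $ k) * fps_X ^ k) oo g" by simp
  also have "\<dots> = (\<Sum>k<n. fps_const (f $ k) * g ^ k)"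
    using g by (simp add: fps_compose_sum_distrib fps_compose_mult_distrib fps_X_power_compose)
  finally have "N * (f oo g) = (\<Sum>k<n. fps_const (f $ k) * (N * g ^ k))"
    by (simp add: sum_distrib_left mult_ac)
  then show ?thesis by (simp add: fps_sum_nth)
qed

text \<open>The series \<open>(1 - t)^(-c)\<close>. Giving its coefficients directly allows every
  rational exponent and shows them to be polynomials in \<open>c\<close>.\<close>

definition neg_binomial :: "rat \<Rightarrow> rat fps" where
  "neg_binomial c = Abs_fps (\<lambda>k. pochhammer c k / fact k)"

lemma neg_binomial_mult: "neg_binomial c * (1 - fps_X) = neg_binomial (c - 1)"
proof (rule fps_ext)
  fix k
  show "(neg_binomial c * (1 - fps_X)) $ k = neg_binomial (c - 1) $ k"
  proof (cases k)
    case 0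
    then show ?thesis by (simp add: neg_binomial_def)
  next
    case (Suc l)
    have "pochhammer c (Suc l) / fact (Suc l) - pochhammer c l / fact l
        = ((c + of_nat l) - of_nat (Suc l)) * pochhammer c l / fact (Suc l)"
      by (simp add: pochhammer_Suc field_simps del: of_nat_Suc)
    also have "\<dots> = pochhammer (c - 1) (Suc l) / fact (Suc l)"
      by (simp add: pochhammer_rec)
    finally show ?thesis
      by (simp add: Suc neg_binomial_def algebra_simps)
  qed
qed

lemma neg_binomial_of_nat: "neg_binomial (- of_nat m) = (1 - fps_X) ^ m"
proof (induction m)
  case 0
  then show ?case by (intro fps_ext) (simp add: neg_binomial_def fps_one_nth pochhammer_0_left)
next
  case (Suc m)
  have "neg_binomial (- of_nat (Suc m)) = neg_binomial (- of_nat m - 1)"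
    by (rule arg_cong[of _ _ neg_binomial]) simp
  also have "\<dots> = (1 - fps_X) ^ Suc m"
    unfolding neg_binomial_mult[symmetric] Suc by simp
  finally show ?case .
qed

text \<open>With \<open>u = 1 - t\<close>, \<open>V\<close> is \<open>1 / u\<close>. The factor
  \<open>H\<close> of \<open>G\<close> is kept apart because its constant term is 1, which makes it
  invertible.\<close>

definition V :: "rat fps" where "V = inverse (1 - fps_X)"
definition H :: "rat fps" where "H = (1 + fps_X) * V"
definition G :: "rat fps" where "G = fps_X * H"

lemma one_minus_X_mult_V: "(1 - fps_X) * V = 1"
  unfolding V_def by (rule inverse_mult_eq_1') simp

lemma G_nth_0 [simp]: "G $ 0 = 0" by (simp add: G_def)
lemma H_nth_0 [simp]: "H $ 0 = 1" by (simp add: H_def V_def)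

lemma neg_binomial_plus: "neg_binomial (c + of_nat i) = neg_binomial c * V ^ i"
proof (induction i)
  case (Suc i)
  have "neg_binomial (c + of_nat (Suc i)) = neg_binomial (c + of_nat (Suc i)) * ((1 - fps_X) * V)"
    by (simp add: one_minus_X_mult_V)
  also have "\<dots> = neg_binomial (c + of_nat i) * V"
    using neg_binomial_mult[of "c + of_nat (Suc i)"] by (simp flip: mult.assoc)
  finally show ?case by (simp add: Suc mult_ac)
qed simp

lemma neg_binomial_minus: "neg_binomial (c - of_nat i) = neg_binomial c * (1 - fps_X) ^ i"
proof (induction i)
  case (Suc i)
  then show ?case
    using neg_binomial_mult[of "c - of_nat i"] by (simp add: algebra_simps)
qed simp

text \<open>Coefficients of \<open>(2/u)^i + u^i\<close> as a polynomial in \<open>G\<close>. It is monic of degree \<open>i\<close>, except that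
  it is 2 for \<open>i = 0\<close>.\<close>
fun row_poly :: "nat \<Rightarrow> rat fps" where
  "row_poly 0 = fps_const 2"
| "row_poly (Suc 0) = fps_const 3 + fps_X"
| "row_poly (Suc (Suc i)) = (fps_const 3 + fps_X) * row_poly (Suc i) - fps_const 2 * row_poly i"

lemma row_poly_deg: "fps_deg_le (row_poly i) i"
proof (induction i rule: row_poly.induct)
  case (3 i)
  then show ?case by (auto simp: fps_deg_le_def algebra_simps)
qed (auto simp: fps_deg_le_def fps_X_def)

lemma row_poly_lead: "row_poly i $ i = (if i = 0 then 2 else 1)"
proof (induction i rule: row_poly.induct)
  case (3 i)
  then show ?case using row_poly_deg[of i] row_poly_deg[of "Suc i"]
    by (auto simp: fps_deg_le_def algebra_simps)
qed auto

lemma linear_compose_G: "(fps_const 3 + fps_X) oo G = fps_const 2 * V + (1 - fps_X)"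
proof -
  have "(fps_const 3 + fps_X) oo G = 3 * ((1 - fps_X) * V) + G"
    by (simp add: fps_compose_add_distrib numeral_fps_const one_minus_X_mult_V)
  also have "\<dots> = 2 * V + (1 - fps_X) * ((1 - fps_X) * V)"
    by (simp add: G_def H_def algebra_simps)
  finally show ?thesis by (simp add: one_minus_X_mult_V numeral_fps_const)
qed

text \<open>The series \<open>2 / u\<close> and \<open>u\<close> have sum \<open>G + 3\<close> and
  product 2, so their power sums obey the recurrence of \<open>row_poly\<close>.\<close>

lemma row_poly_compose: "row_poly i oo G = fps_const (2 ^ i) * V ^ i + (1 - fps_X) ^ i"
proof (induction i rule: row_poly.induct)
  case 1
  show ?case by (simp add: numeral_fps_const flip: fps_const_add)
next
  case 2
  show ?case by (simp add: linear_compose_G)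
next
  case (3 i)
  have four: "fps_const (4 :: rat) = fps_const 2 * fps_const 2" by simp
  have "row_poly (Suc (Suc i)) oo G = (fps_const 2 * V + (1 - fps_X)) * (row_poly (Suc i) oo G)
      - fps_const 2 * (row_poly i oo G)"
    by (simp add: fps_compose_sub_distrib fps_compose_mult_distrib linear_compose_G)
  also have "\<dots> = fps_const (2 ^ Suc (Suc i)) * V ^ Suc (Suc i) + (1 - fps_X) ^ Suc (Suc i)
      + fps_const 2 * ((1 - fps_X) * V - 1) * (fps_const (2 ^ i) * V ^ i + (1 - fps_X) ^ i)"
    unfolding 3 by (simp add: four algebra_simps flip: fps_const_mult fps_const_power)
  finally show ?case by (simp add: one_minus_X_mult_V)
qed

definition red_mat :: "nat \<Rightarrow> rat \<Rightarrow> rat mat" where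
  "red_mat n x = mat n n (\<lambda>(i, j). (neg_binomial (x + 1) * G ^ i) $ (2 * j + 1))"

lemma gchoose_eq_pochhammer:
  "(x + of_nat k) gchoose k = pochhammer (x + 1) k / fact k" for x :: "'a::field_char_0"
  by (simp add: gbinomial_pochhammer')

text \<open>The original matrix is \<open>L * red_mat n x\<close> with \<open>L\<close> lower
  triangular. The factor 2 comes from row 0, where the two binomial terms coincide; the other
  diagonal entries of \<open>L\<close> are 1.\<close>

lemma D2_eq_red_mat:
  assumes n: "n > 0"
  shows "D2 n (x :: rat) = 2 * det (red_mat n x)"
proof -
  define L where "L = mat n n (\<lambda>(i, k). row_poly i $ k)"
  have "mat n n (\<lambda>(i, j).
     2 ^ i * ((x + of_nat i + 2 * of_nat j + 1) gchoose (2 * j + 1))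
     + ((x - of_nat i + 2 * of_nat j + 1) gchoose (2 * j + 1))) = L * red_mat n x" (is "?A = _")
  proof (rule eq_matI)
    fix i j assume "i < dim_row (L * red_mat n x)" "j < dim_col (L * red_mat n x)"
    then have ij: "i < n" "j < n" by (auto simp: L_def red_mat_def)
    have 1: "(x + of_nat i + 2 * of_nat j + 1) gchoose (2 * j + 1)
        = neg_binomial (x + 1 + of_nat i) $ (2 * j + 1)"
      using gchoose_eq_pochhammer[of "x + of_nat i" "2 * j + 1"]
      by (simp add: neg_binomial_def algebra_simps)
    have 2: "(x - of_nat i + 2 * of_nat j + 1) gchoose (2 * j + 1)
        = neg_binomial (x + 1 - of_nat i) $ (2 * j + 1)"
      using gchoose_eq_pochhammer[of "x - of_nat i" "2 * j + 1"]
      by (simp add: neg_binomial_def algebra_simps)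
    have "?A $$ (i, j) = (neg_binomial (x + 1) * (row_poly i oo G)) $ (2 * j + 1)"
      unfolding row_poly_compose using ij
      by (simp only: index_mat case_prod_conv 1 2 neg_binomial_plus neg_binomial_minus)
         (simp add: distrib_left mult.left_commute[of _ "fps_const _"])
    also have "\<dots> = (\<Sum>k<n. row_poly i $ k * (neg_binomial (x + 1) * G ^ k) $ (2 * j + 1))"
      by (rule fps_mult_compose_nth_of_deg_le[OF row_poly_deg]) (use ij in auto)
    also have "\<dots> = (L * red_mat n x) $$ (i, j)"
      using ij by (simp add: L_def red_mat_def scalar_prod_def lessThan_atLeast0)
    finally show "?A $$ (i, j) = (L * red_mat n x) $$ (i, j)" .
  qed (auto simp: L_def red_mat_def)
  moreover have "det L = 2"
  proof -
    have "det L = prod_list (diag_mat L)"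
      using row_poly_deg by (intro det_lower_triangular[of n]) (auto simp: L_def fps_deg_le_def)
    also have "\<dots> = (\<Prod>i=0..<n. if i = 0 then 2 else 1)"
      by (simp add: prod_list_diag_prod L_def row_poly_lead)
    also have "\<dots> = 2" using n by simp
    finally show ?thesis .
  qed
  ultimately show ?thesis
    unfolding D2_def by (simp add: det_mult[of _ n] L_def red_mat_def)
qed

section \<open>Zeros of the determinant\<close>

text \<open>Every term of the Leibniz expansion contains one entry from each row in
  \<open>S\<close>.\<close>

lemma power_card_dvd_det:
  fixes A :: "'a::comm_ring_1 mat"
  assumes A: "A \<in> carrier_mat n n" and S: "S \<subseteq> {0..<n}"
    and dvd: "\<And>i j. i \<in> S \<Longrightarrow> j < n \<Longrightarrow> q dvd A $$ (i, j)"
  shows "q ^ card S dvd det A"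
  unfolding det_def'[OF A]
proof (intro dvd_sum dvd_mult)
  fix p assume p: "p \<in> {p. p permutes {0..<n}}"
  have "q ^ card S = (\<Prod>i\<in>S. q)" by simp
  also have "\<dots> dvd (\<Prod>i\<in>S. A $$ (i, p i))"
  proof (rule prod_dvd_prod)
    fix i assume "i \<in> S"
    moreover from this have "p i < n" using p S permutes_in_image[of p "{0..<n}" i] by auto
    ultimately show "q dvd A $$ (i, p i)" by (rule dvd)
  qed
  also have "\<dots> dvd (\<Prod>i = 0..<n. A $$ (i, p i))"
    using S by (intro prod_dvd_prod_subset) auto
  finally show "q ^ card S dvd (\<Prod>i = 0..<n. A $$ (i, p i))" .
qed

text \<open>If the rows of \<open>C\<close> in \<open>S\<close> are left kernel vectors at
  \<open>a\<close>, then these rows of \<open>C * A\<close> are divisible by the linear factor, and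
  the constant \<open>det C\<close> does not affect divisibility. So independent kernel vectors
  bound the order of the zero from below.\<close>

lemma root_multiplicity_det:
  fixes A :: "'a::field poly mat" and C :: "'a mat"
  assumes A: "A \<in> carrier_mat n n" and C: "C \<in> carrier_mat n n" and det: "det C \<noteq> 0"
    and S: "S \<subseteq> {0..<n}"
    and ker: "\<And>i j. i \<in> S \<Longrightarrow> j < n \<Longrightarrow> (\<Sum>k<n. C $$ (i, k) * poly (A $$ (k, j)) a) = 0"
  shows "[:-a, 1:] ^ card S dvd det A"
proof -
  interpret const: comm_ring_hom "\<lambda>c :: 'a. [:c:]"
    by unfold_locales (auto simp: one_pCons)
  let ?C = "map_mat (\<lambda>c. [:c:]) C"
  have "[:-a, 1:] ^ card S dvd det (?C * A)"
  proof (rule power_card_dvd_det[OF _ S])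
    fix i j assume ij: "i \<in> S" "j < n"
    then have i: "i < n" using S by auto
    have "poly ((?C * A) $$ (i, j)) a = (\<Sum>k<n. C $$ (i, k) * poly (A $$ (k, j)) a)"
      using i ij A C by (simp add: scalar_prod_def poly_sum lessThan_atLeast0)
    then show "[:-a, 1:] dvd (?C * A) $$ (i, j)"
      using ker[OF ij] by (simp add: poly_eq_0_iff_dvd)
  qed (use A C in auto)
  also have "det (?C * A) = [:det C:] * det A"
    using A C by (simp add: det_mult[of _ n])
  finally show ?thesis using det by (simp add: dvd_smult_iff)
qed

text \<open>This is \<open>red_mat\<close> with the polynomial variable in place of
  \<open>x\<close>. The product of series is written out as a convolution because
  \<open>neg_binomial\<close> takes rational arguments only.\<close>

definition poly_mat :: "nat \<Rightarrow> rat poly mat" where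
  "poly_mat n = mat n n (\<lambda>(i, j). \<Sum>k=0..2*j+1.
     smult (G ^ i $ k / fact (2 * j + 1 - k)) (pochhammer [:1, 1:] (2 * j + 1 - k)))"

lemma poly_mat_carrier [simp]: "poly_mat n \<in> carrier_mat n n"
  by (simp add: poly_mat_def)

lemma poly_pochhammer: "poly (pochhammer p k) a = pochhammer (poly p a) k"
  by (induction k) (auto simp: pochhammer_Suc)

lemma poly_poly_mat:
  assumes "i < n" "j < n"
  shows "poly (poly_mat n $$ (i, j)) x = (neg_binomial (x + 1) * G ^ i) $ (2 * j + 1)"
proof -
  define r where "r = 2 * j + 1"
  have "poly_mat n $$ (i, j)
      = (\<Sum>k=0..r. smult (G ^ i $ k / fact (r - k)) (pochhammer [:1, 1:] (r - k)))"
    using assms by (simp only: poly_mat_def index_mat case_prod_conv r_def)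
  then have "poly (poly_mat n $$ (i, j)) x = (G ^ i * neg_binomial (x + 1)) $ r"
    by (simp add: neg_binomial_def fps_mult_nth poly_sum poly_pochhammer add.commute)
  then show ?thesis by (simp only: r_def mult.commute)
qed

lemma poly_det: "poly (det A) x = det (map_mat (\<lambda>p. poly p x) A)" for x :: "'a::comm_ring_1"
proof -
  interpret comm_ring_hom "\<lambda>p. poly p x" by unfold_locales auto
  show ?thesis by simp
qed

lemma poly_det_poly_mat: "poly (det (poly_mat n)) x = det (red_mat n x)"
  unfolding poly_det
  by (rule arg_cong[of _ _ det], rule eq_matI) (auto simp: red_mat_def poly_poly_mat carrier_matD[OF poly_mat_carrier])

section \<open>Left kernel vectors at negative integers\<close>

lemma one_minus_X_mult_G: "(1 - fps_X) * G = fps_X * (1 + fps_X)"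
  using one_minus_X_mult_V by (simp add: G_def H_def mult_ac)

text \<open>At \<open>x = -m\<close> the prefactor is \<open>u^(m-1)\<close>. With
  \<open>b = m - 1 - 2 i\<close> it is shared out as
  \<open>(u^2 G)^i (u (1 + G))^b = (t (1 - t^2))^i (1 + t^2)^b\<close>. This is even for even
  \<open>i\<close>, while the columns of the matrix record odd coefficients.\<close>

lemma row_kernel:
  assumes m: "even i" "2 * i + 1 \<le> m"
  shows "even_fps ((1 - fps_X) ^ (m - 1) * ((fps_X ^ i * (1 + fps_X) ^ (m - 1 - 2 * i)) oo G))"
proof -
  define b where "b = m - 1 - 2 * i"
  have m': "m - 1 = i + i + b" using m by (simp add: b_def)
  have "(fps_X ^ i * (1 + fps_X) ^ b) oo G = G ^ i * (1 + G) ^ b"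
    by (simp add: fps_compose_mult_distrib fps_compose_add_distrib fps_X_power_compose
        fps_compose_power flip: fps_compose_power)
  then have "(1 - fps_X) ^ (m - 1) * ((fps_X ^ i * (1 + fps_X) ^ b) oo G)
      = ((1 - fps_X) * ((1 - fps_X) * G)) ^ i * ((1 - fps_X) * (1 + G)) ^ b"
    unfolding m' by (simp add: power_add power_mult_distrib mult_ac)
  also have "(1 - fps_X) * ((1 - fps_X) * G) = fps_X * (1 - fps_X ^ 2)"
    unfolding one_minus_X_mult_G by (simp add: algebra_simps power2_eq_square)
  also have "(1 - fps_X) * (1 + G) = 1 + fps_X ^ 2"
    unfolding distrib_left one_minus_X_mult_G by (simp add: algebra_simps power2_eq_square)
  finally show ?thesis
    using m(1) unfolding b_def[symmetric] power_mult_distrib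
    by (auto intro!: even_fps_mult even_fps_power even_fps_add even_fps_diff even_fps_X_power
        simp del: power_mult_distrib)
qed

text \<open>The kernel vector for \<open>i\<close> consists of the coefficients of a polynomial of
  degree \<open>m - 1 - i\<close>, which is below \<open>n\<close> because
  \<open>m <= n + i\<close>; so it fits the matrix.\<close>

lemma dvd_det_poly_mat_row:
  assumes "m \<ge> 1"
  shows "[:of_nat m, 1:] ^ card {i. i < n \<and> even i \<and> 2 * i + 1 \<le> m \<and> m \<le> n + i} dvd det (poly_mat n)"
proof -
  define S where "S = {i. i < n \<and> even i \<and> 2 * i + 1 \<le> m \<and> m \<le> n + i}"
  define f :: "nat \<Rightarrow> rat fps" where "f i = fps_X ^ i * (1 + fps_X) ^ (m - 1 - 2 * i)" for i
  \<comment> \<open>The kernel vector for \<open>i\<close> starts with entry 1 at position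
    \<open>i\<close>, and the other rows are unit vectors; hence \<open>C\<close> is upper
    triangular with unit diagonal.\<close>
  define C where "C = mat n n (\<lambda>(i, k). if i \<in> S then f i $ k else of_bool (i = k))"
  have "[:- (- of_nat m), 1:] ^ card S dvd det (poly_mat n)"
  proof (rule root_multiplicity_det)
    have "det C = prod_list (diag_mat C)"
      by (rule det_upper_triangular[of _ n])
        (auto simp: C_def f_def fps_X_power_mult_nth)
    also have "\<dots> = 1"
      by (auto simp: prod_list_diag_prod C_def f_def fps_X_power_mult_nth fps_power_zeroth intro!: prod.neutral)
    finally show "det C \<noteq> 0" by simp
  next
    fix i j assume ij: "i \<in> S" "j < n"
    then have i: "even i" "2 * i + 1 \<le> m" "m \<le> n + i" "i < n" by (auto simp: S_def)
    have "fps_deg_le (f i) (i + (m - 1 - 2 * i) * 1)"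
      unfolding f_def by (intro fps_deg_le_mult fps_deg_le_X_power fps_deg_le_power fps_deg_le_linear)
    then have deg: "fps_deg_le (f i) (m - 1 - i)" using i by (simp add: algebra_simps)
    have "1 - rat_of_nat m = - of_nat (m - 1)" using assms by (simp add: of_nat_diff)
    then have N: "neg_binomial (1 - of_nat m) = (1 - fps_X) ^ (m - 1)"
      by (simp only: neg_binomial_of_nat)
    have "(\<Sum>k<n. C $$ (i, k) * poly (poly_mat n $$ (k, j)) (- of_nat m))
        = (\<Sum>k<n. f i $ k * ((1 - fps_X) ^ (m - 1) * G ^ k) $ (2 * j + 1))"
      using ij i by (intro sum.cong) (auto simp: C_def poly_poly_mat N)
    also have "\<dots> = ((1 - fps_X) ^ (m - 1) * (f i oo G)) $ (2 * j + 1)"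
      by (rule fps_mult_compose_nth_of_deg_le[OF deg, symmetric]) (use i in auto)
    also have "\<dots> = 0" unfolding f_def using row_kernel[of i m] i by (intro even_fpsD) auto
    finally show "(\<Sum>k<n. C $$ (i, k) * poly (poly_mat n $$ (k, j)) (- of_nat m)) = 0" .
  qed (auto simp: C_def S_def)
  then show ?thesis by (simp add: S_def)
qed

section \<open>Right kernel vectors at negative integers\<close>

text \<open>A linear combination of odd coefficients of \<open>g\<close>, that is of columns, is
  thus a single coefficient of a product, to be treated as a residue.\<close>

lemma even_fps_mult_nth_odd:
  assumes "even_fps f"
  shows "(f * g) $ (2 * r + 1) = (\<Sum>k\<le>r. f $ (2 * r - 2 * k) * g $ (2 * k + 1))"
proof -
  have "(f * g) $ (2 * r + 1) = (\<Sum>k=0..2*r+1. g $ k * f $ (2 * r + 1 - k))"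
    unfolding mult.commute[of f] by (rule fps_mult_nth)
  also have "\<dots> = (\<Sum>k\<in>(\<lambda>k. 2 * k + 1) ` {..r}. g $ k * f $ (2 * r + 1 - k))"
  proof (rule sum.mono_neutral_right)
    show "\<forall>k\<in>{0..2*r+1} - (\<lambda>k. 2 * k + 1) ` {..r}. g $ k * f $ (2 * r + 1 - k) = 0"
    proof
      fix k assume k: "k \<in> {0..2*r+1} - (\<lambda>k. 2 * k + 1) ` {..r}"
      have "even k"
      proof (rule ccontr)
        assume "odd k"
        then obtain l where "k = 2 * l + 1" by (elim oddE)
        then show False using k by auto
      qed
      then show "g $ k * f $ (2 * r + 1 - k) = 0" using k even_fpsD[OF assms] by simp
    qed
  qed auto
  also have "\<dots> = (\<Sum>k\<le>r. f $ (2 * r - 2 * k) * g $ (2 * k + 1))"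
    by (subst sum.reindex) (auto simp: inj_on_def mult.commute)
  finally show ?thesis .
qed

text \<open>The even Laurent series of the right kernel vectors for \<open>l = r + 1\<close>, times \<open>fps_X ^ (2 * r + 2)\<close>.\<close>
definition col_fps :: "nat \<Rightarrow> nat \<Rightarrow> rat fps" where
  "col_fps m r = (1 - 6 * fps_X ^ 2 + fps_X ^ 4) * inverse (1 - fps_X ^ 2) ^ (2 * r + 2)
     * (1 + fps_X ^ 2) ^ (4 * r + 2 - m)"

lemma even_col_fps: "even_fps (col_fps m r)"
  unfolding col_fps_def
  by (intro even_fps_mult even_fps_power even_fps_inverse even_fps_add even_fps_diff even_fps_X_power)
    auto

lemma col_fps_nth_0 [simp]: "col_fps m r $ 0 = 1"
  by (simp add: col_fps_def fps_mult_nth_0 fps_power_zeroth)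

lemma deriv_G: "(1 - fps_X) ^ 2 * fps_deriv G = 1 + 2 * fps_X - fps_X ^ 2"
proof -
  have "(1 - fps_X) * fps_deriv G = 1 + 2 * fps_X + G"
    using arg_cong[OF one_minus_X_mult_G, of fps_deriv] by (simp add: algebra_simps)
  then have "(1 - fps_X) ^ 2 * fps_deriv G = (1 - fps_X) * (1 + 2 * fps_X + G)"
    by (simp add: power2_eq_square mult.assoc)
  also have "\<dots> = 1 + 2 * fps_X - fps_X ^ 2"
    unfolding distrib_left[of _ _ G] one_minus_X_mult_G
    by (simp add: algebra_simps power2_eq_square)
  finally show ?thesis .
qed

text \<open>One has \<open>u (1 - G) = 1 - 2 X - X^2\<close> and
  \<open>u^2 G' = 1 + 2 X - X^2\<close>, with product \<open>1 - 6 X^2 + X^4\<close>; this explains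
  the first factor of \<open>col_fps\<close>. The others come from
  \<open>u (1 + G) = 1 + X^2\<close> and \<open>(1 + X) / H = u\<close>.\<close>

lemma col_fps_eq:
  assumes m: "1 \<le> m" "m \<le> 4 * r + 2"
  shows "col_fps m r * (1 - fps_X) ^ (m - 1)
    = (((1 - fps_X) * (1 + fps_X) ^ (4 * r + 2 - m)) oo G) * fps_deriv G * inverse H ^ (2 * r + 2)"
    (is "?L = ?R")
proof -
  define b where "b = 4 * r + 2 - m"
  define p where "p = 2 * r + 2"
  define I K where "I = inverse (1 - fps_X ^ 2 :: rat fps)" and "K = inverse H"
  have I: "(1 - fps_X) * (1 + fps_X) * I = 1"
  proof -
    have "(1 - fps_X ^ 2) * I = 1" unfolding I_def by (rule inverse_mult_eq_1') simp
    then show ?thesis by (simp add: algebra_simps power2_eq_square)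
  qed
  have "H * K = 1" unfolding K_def by (rule inverse_mult_eq_1') simp
  moreover have "(1 - fps_X) * H = 1 + fps_X" using one_minus_X_mult_V by (simp add: H_def mult_ac)
  ultimately have K: "(1 + fps_X) * K = 1 - fps_X" by (metis mult.assoc mult.right_neutral)
  have G1: "(1 - fps_X) * (1 + G) = 1 + fps_X ^ 2"
    unfolding distrib_left one_minus_X_mult_G by (simp add: algebra_simps power2_eq_square)
  have G2: "(1 - fps_X) * (1 - G) = 1 - 2 * fps_X - fps_X ^ 2"
    unfolding right_diff_distrib one_minus_X_mult_G by (simp add: algebra_simps power2_eq_square)
  define W :: "rat fps" where "W = 1 - 6 * fps_X ^ 2 + fps_X ^ 4"
  have W: "W = (1 - 2 * fps_X - fps_X ^ 2) * (1 + 2 * fps_X - fps_X ^ 2)"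
    by (simp add: W_def algebra_simps power2_eq_square numeral_eq_Suc)
  have mb: "m - 1 + (b + 3) = p + p" using m by (simp add: b_def p_def)
  have comp: "((1 - fps_X) * (1 + fps_X) ^ b) oo G = (1 - G) * (1 + G) ^ b"
    by (simp add: fps_compose_mult_distrib fps_compose_add_distrib fps_compose_sub_distrib
        flip: fps_compose_power)
  \<comment> \<open>\<open>F\<close> clears denominators: \<open>1 - G\<close>,
    \<open>(1 + G)^b\<close> and \<open>G'\<close> together take \<open>b + 3\<close> factors
    \<open>u\<close>, and \<open>(1 + X)^p\<close> turns \<open>inverse H ^ p\<close> into
    \<open>u^p\<close>.\<close>
  define F :: "rat fps" where "F = (1 - fps_X) ^ (b + 3) * (1 + fps_X) ^ p"
  have "F * ?L = W * (1 + fps_X ^ 2) ^ b * (1 + fps_X) ^ p * I ^ p * ((1 - fps_X) ^ (m - 1 + (b + 3)))"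
    unfolding F_def col_fps_def b_def[symmetric] p_def[symmetric] I_def[symmetric] W_def[symmetric]
    by (simp add: power_add mult_ac)
  also have "\<dots> = W * (1 + fps_X ^ 2) ^ b * (1 - fps_X) ^ p * ((1 - fps_X) * (1 + fps_X) * I) ^ p"
    unfolding mb by (simp add: power_add power_mult_distrib mult_ac)
  also have "\<dots> = W * (1 + fps_X ^ 2) ^ b * (1 - fps_X) ^ p" by (simp add: I)
  also have "\<dots> = ((1 - fps_X) * (1 - G)) * ((1 - fps_X) * (1 + G)) ^ b
      * ((1 - fps_X) ^ 2 * fps_deriv G) * ((1 + fps_X) * K) ^ p"
    unfolding G1 G2 deriv_G K W by (simp add: mult_ac)
  also have "\<dots> = F * ?R"
    unfolding b_def[symmetric] p_def[symmetric] K_def[symmetric] comp F_def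
    by (simp add: power_add power_mult_distrib power2_eq_square numeral_eq_Suc mult_ac)
  finally have "F * ?L = F * ?R" .
  moreover have "F \<noteq> 0"
  proof
    assume "F = 0"
    then have "F $ 0 = 0" by simp
    then show False by (simp add: F_def fps_mult_nth_0 fps_power_zeroth)
  qed
  ultimately show ?thesis by simp
qed

text \<open>By \<open>col_fps_eq\<close> the sum is the residue of
  \<open>(1 - G) (1 + G)^b G^(i-2r-2) dG\<close>. Expanded in powers of \<open>G\<close>, this
  contains only exponents for which \<open>fps_no_residue\<close> applies.\<close>

lemma column_kernel:
  assumes i: "i < n" and m: "2 * r + 2 + n \<le> m" "m \<le> 4 * r + 2"
  shows "(\<Sum>k\<le>r. col_fps m r $ (2 * r - 2 * k) * ((1 - fps_X) ^ (m - 1) * G ^ i) $ (2 * k + 1)) = 0"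
proof -
  define b where "b = 4 * r + 2 - m"
  define N where "N = G ^ i * fps_deriv G * inverse H ^ (2 * r + 2)"
  define f :: "rat fps" where "f = (1 - fps_X) * (1 + fps_X) ^ b"
  have deg: "fps_deg_le f (1 + b * 1)"
    unfolding f_def by (intro fps_deg_le_mult fps_deg_le_power fps_deg_le_linear)
  have "(\<Sum>k\<le>r. col_fps m r $ (2 * r - 2 * k) * ((1 - fps_X) ^ (m - 1) * G ^ i) $ (2 * k + 1))
      = (col_fps m r * ((1 - fps_X) ^ (m - 1) * G ^ i)) $ (2 * r + 1)"
    by (rule even_fps_mult_nth_odd[OF even_col_fps, symmetric])
  also have "col_fps m r * ((1 - fps_X) ^ (m - 1) * G ^ i)
      = col_fps m r * (1 - fps_X) ^ (m - 1) * G ^ i"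
    by (simp only: mult.assoc)
  also have "\<dots> = (f oo G) * fps_deriv G * inverse H ^ (2 * r + 2) * G ^ i"
    using m by (subst col_fps_eq) (simp_all only: f_def b_def)
  also have "\<dots> = N * (f oo G)" by (simp only: N_def mult_ac)
  also have "\<dots> $ (2 * r + 1) = (\<Sum>k<b+2. f $ k * (N * G ^ k) $ (2 * r + 1))"
    by (rule fps_mult_compose_nth_of_deg_le[OF deg]) auto
  also have "\<dots> = 0"
  proof (rule sum.neutral, rule ballI)
    fix k assume "k \<in> {..<b+2}"
    \<comment> \<open>Here \<open>i + k <= (n - 1) + (b + 1) <= 2 r\<close> by the lower bound on
      \<open>m\<close>, so the exponent of \<open>G\<close> before \<open>dG\<close> is at most
      -2.\<close>
    then have "i + k < 2 * r + 1" using i m by (auto simp: b_def)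
    then have "(G ^ (i + k) * fps_deriv G * inverse H ^ (2 * r + 1 + 1)) $ (2 * r + 1) = 0"
      unfolding G_def by (intro fps_no_residue) auto
    moreover have "N * G ^ k = G ^ (i + k) * fps_deriv G * inverse H ^ (2 * r + 1 + 1)"
      by (simp add: N_def power_add mult_ac)
    ultimately show "f $ k * (N * G ^ k) $ (2 * r + 1) = 0" by simp
  qed
  finally show ?thesis .
qed

text \<open>Columns are treated as rows of the transpose. The vector for \<open>r\<close> involves
  only columns up to \<open>r\<close> and has entry \<open>col_fps m r $ 0 = 1\<close> there, so
  \<open>C\<close> is lower triangular with unit diagonal.\<close>

lemma dvd_det_poly_mat_column:
  assumes "m \<ge> 1"
  shows "[:of_nat m, 1:] ^ card {r. r < n \<and> 2 * r + 2 + n \<le> m \<and> m \<le> 4 * r + 2} dvd det (poly_mat n)"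
proof -
  define S where "S = {r. r < n \<and> 2 * r + 2 + n \<le> m \<and> m \<le> 4 * r + 2}"
  define C where "C = mat n n (\<lambda>(r, k). if r \<in> S then
    if k \<le> r then col_fps m r $ (2 * r - 2 * k) else 0 else of_bool (r = k))"
  have "[:- (- of_nat m), 1:] ^ card S dvd det (transpose_mat (poly_mat n))"
  proof (rule root_multiplicity_det)
    have "det C = prod_list (diag_mat C)"
      by (rule det_lower_triangular[of n]) (auto simp: C_def)
    also have "\<dots> = 1"
      by (auto simp: prod_list_diag_prod C_def intro!: prod.neutral)
    finally show "det C \<noteq> 0" by simp
  next
    fix r i assume ri: "r \<in> S" "i < n"
    then have r: "r < n" "2 * r + 2 + n \<le> m" "m \<le> 4 * r + 2" by (auto simp: S_def)
    have "1 - rat_of_nat m = - of_nat (m - 1)" using assms by (simp add: of_nat_diff)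
    then have N: "neg_binomial (1 - of_nat m) = (1 - fps_X) ^ (m - 1)"
      by (simp only: neg_binomial_of_nat)
    have "(\<Sum>k<n. C $$ (r, k) * poly (transpose_mat (poly_mat n) $$ (k, i)) (- of_nat m))
        = (\<Sum>k<n. if k \<le> r then col_fps m r $ (2 * r - 2 * k)
            * ((1 - fps_X) ^ (m - 1) * G ^ i) $ (2 * k + 1) else 0)"
      using ri r by (intro sum.cong) (auto simp: C_def poly_poly_mat N carrier_matD[OF poly_mat_carrier])
    also have "\<dots> = (\<Sum>k\<le>r. col_fps m r $ (2 * r - 2 * k)
            * ((1 - fps_X) ^ (m - 1) * G ^ i) $ (2 * k + 1))"
      using r by (intro sum.mono_neutral_cong_right) auto
    also have "\<dots> = 0" using column_kernel ri r by simp
    finally show "(\<Sum>k<n. C $$ (r, k) * poly (transpose_mat (poly_mat n) $$ (k, i)) (- of_nat m)) = 0" .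
  qed (auto simp: C_def S_def)
  then show ?thesis by (simp add: S_def det_transpose[OF poly_mat_carrier])
qed

section \<open>Degree and leading coefficient\<close>

lemma coeff_mult_top:
  assumes "degree p \<le> a" "degree q \<le> b"
  shows "coeff (p * q) (a + b) = coeff p a * coeff q b"
proof -
  have "coeff (p * q) (a + b) = (\<Sum>i\<le>a+b. if i = a then coeff p a * coeff q b else 0)"
    unfolding coeff_mult
  proof (rule sum.cong)
    fix i assume "i \<in> {..a + b}"
    have "coeff p i = 0" if "i > a" using that assms(1) by (intro coeff_eq_0) simp
    moreover have "coeff q (a + b - i) = 0" if "i < a" using that assms(2) by (intro coeff_eq_0) simp
    ultimately show "coeff p i * coeff q (a + b - i) = (if i = a then coeff p a * coeff q b else 0)"
      by (cases i a rule: linorder_cases) auto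
  qed simp
  then show ?thesis by simp
qed

lemma coeff_prod_top:
  fixes f :: "'i \<Rightarrow> 'a::comm_ring_1 poly"
  assumes "\<And>i. i \<in> S \<Longrightarrow> degree (f i) \<le> d i"
  shows "degree (\<Prod>i\<in>S. f i) \<le> (\<Sum>i\<in>S. d i)"
    and "coeff (\<Prod>i\<in>S. f i) (\<Sum>i\<in>S. d i) = (\<Prod>i\<in>S. coeff (f i) (d i))"
proof -
  have "degree (\<Prod>i\<in>S. f i) \<le> (\<Sum>i\<in>S. d i)
    \<and> coeff (\<Prod>i\<in>S. f i) (\<Sum>i\<in>S. d i) = (\<Prod>i\<in>S. coeff (f i) (d i))"
    using assms
  proof (induction S rule: infinite_finite_induct)
    case (insert i S)
    then show ?case
      by (auto simp: coeff_mult_top intro!: order.trans[OF degree_mult_le] add_mono)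
  qed auto
  then show "degree (\<Prod>i\<in>S. f i) \<le> (\<Sum>i\<in>S. d i)"
    and "coeff (\<Prod>i\<in>S. f i) (\<Sum>i\<in>S. d i) = (\<Prod>i\<in>S. coeff (f i) (d i))" by auto
qed

text \<open>Each Leibniz term takes one entry from every column, so degree bounds that depend on the
  column only have the same sum for all permutations.\<close>

lemma coeff_det_top:
  fixes A :: "'a::comm_ring_1 poly mat"
  assumes A: "A \<in> carrier_mat n n"
    and deg: "\<And>i j. i < n \<Longrightarrow> j < n \<Longrightarrow> degree (A $$ (i, j)) \<le> d j"
  shows "degree (det A) \<le> (\<Sum>j<n. d j)"
    and "coeff (det A) (\<Sum>j<n. d j) = det (mat n n (\<lambda>(i, j). coeff (A $$ (i, j)) (d j)))"
proof -
  have s: "degree (signof p * q) = degree q" "coeff (signof p * q) k = signof p * coeff q k"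
    for p :: "nat \<Rightarrow> nat" and q :: "'a poly" and k
    by (cases p rule: sign_cases; simp)+
  have d: "(\<Sum>j<n. d j) = (\<Sum>i=0..<n. d (p i))" if "p permutes {0..<n}" for p
    using sum.permute[OF that, of d] by (simp add: lessThan_atLeast0 o_def)
  have lt: "p i < n" if "p permutes {0..<n}" "i < n" for p i
    using permutes_in_image[OF that(1), of i] that(2) by simp
  show "degree (det A) \<le> (\<Sum>j<n. d j)"
    unfolding det_def'[OF A]
    by (intro degree_sum_le) (auto simp: finite_permutations s d deg lt intro!: coeff_prod_top)
  show "coeff (det A) (\<Sum>j<n. d j) = det (mat n n (\<lambda>(i, j). coeff (A $$ (i, j)) (d j)))"
    unfolding det_def'[OF A] det_def'[OF mat_carrier] coeff_sum
  proof (intro sum.cong refl)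
    fix p assume p: "p \<in> {p. p permutes {0..<n}}"
    have "coeff (\<Prod>i = 0..<n. A $$ (i, p i)) (\<Sum>i = 0..<n. d (p i))
        = (\<Prod>i = 0..<n. coeff (A $$ (i, p i)) (d (p i)))"
      by (rule coeff_prod_top) (use p deg lt in auto)
    then show "coeff (signof p * (\<Prod>i = 0..<n. A $$ (i, p i))) (\<Sum>j<n. d j)
        = signof p * (\<Prod>i = 0..<n. mat n n (\<lambda>(i, j). coeff (A $$ (i, j)) (d j)) $$ (i, p i))"
      using p by (simp add: s d lt)
  qed
qed

text \<open>The coefficients of \<open>\<Prod>l<i. 2 * y + 1 - l\<close> in the basis of the falling factorials of \<open>y\<close>.\<close>
fun falling_coeff :: "nat \<Rightarrow> nat \<Rightarrow> rat" where
  "falling_coeff 0 k = of_bool (k = 0)"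
| "falling_coeff (Suc i) k = (2 * of_nat k + 1 - of_nat i) * falling_coeff i k
     + (if k = 0 then 0 else 2 * falling_coeff i (k - 1))"

lemma falling_coeff_eq_0: "i < k \<Longrightarrow> falling_coeff i k = 0"
  by (induction i arbitrary: k) auto

lemma falling_coeff_diag: "falling_coeff i i = 2 ^ i"
  by (induction i) (auto simp: falling_coeff_eq_0)

text \<open>The new factor splits as \<open>2 y + 1 - i = 2 (y - k) + (2 k + 1 - i)\<close>, whose
  first summand lengthens the falling factorial by one; this is the recursion of
  \<open>falling_coeff\<close>.\<close>

lemma falling_coeff_sum:
  "(\<Sum>k\<le>i. falling_coeff i k * (\<Prod>l<k. y - of_nat l)) = (\<Prod>l<i. 2 * y + 1 - of_nat l)"
proof (induction i)
  case (Suc i)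
  define P where "P k = (\<Prod>l<k. y - of_nat l)" for k
  have PS: "2 * P (Suc k) = (2 * y + 1 - of_nat i) * P k - (2 * of_nat k + 1 - of_nat i) * P k" for k
    by (simp add: P_def algebra_simps)
  have "(\<Sum>k\<le>Suc i. falling_coeff (Suc i) k * P k)
      = (\<Sum>k\<le>Suc i. (2 * of_nat k + 1 - of_nat i) * falling_coeff i k * P k)
        + (\<Sum>k\<le>Suc i. (if k = 0 then 0 else 2 * falling_coeff i (k - 1)) * P k)"
    by (simp only: falling_coeff.simps distrib_right sum.distrib)
  also have "(\<Sum>k\<le>Suc i. (if k = 0 then 0 else 2 * falling_coeff i (k - 1)) * P k)
      = (\<Sum>k\<le>i. falling_coeff i k * (2 * P (Suc k)))"
    by (simp add: sum.atMost_Suc_shift mult_ac del: sum.atMost_Suc)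
  also have "(\<Sum>k\<le>Suc i. (2 * of_nat k + 1 - of_nat i) * falling_coeff i k * P k)
      = (\<Sum>k\<le>i. (2 * of_nat k + 1 - of_nat i) * falling_coeff i k * P k)"
    by (simp add: falling_coeff_eq_0)
  also have "\<dots> + (\<Sum>k\<le>i. falling_coeff i k * (2 * P (Suc k)))
      = (\<Sum>k\<le>i. falling_coeff i k * P k) * (2 * y + 1 - of_nat i)"
    unfolding PS sum_distrib_right sum.distrib[symmetric]
    by (intro sum.cong refl) (simp add: algebra_simps)
  finally show ?case using Suc by (simp add: P_def)
qed simp

lemma prod_falling_eq_fact:
  "(\<Prod>l<i. of_nat a - of_nat l) = (if i \<le> a then fact a / fact (a - i) else (0 :: rat))"
proof (cases "i \<le> a")
  case True
  then show ?thesis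
  proof (induction i)
    case (Suc i)
    then have "a - i = Suc (a - Suc i)" by simp
    then have "fact (a - i) = (of_nat a - of_nat i) * (fact (a - Suc i) :: rat)"
      using Suc.prems by (simp add: of_nat_diff)
    moreover have "(of_nat a - of_nat i :: rat) \<noteq> 0" using Suc.prems by simp
    moreover have "(\<Prod>l<Suc i. of_nat a - of_nat l)
        = fact a / fact (a - i) * (of_nat a - of_nat i :: rat)"
      using Suc by simp
    ultimately show ?case using Suc.prems by simp
  qed simp
next
  case False
  then have "(of_nat a - of_nat a :: rat) = 0" "a \<in> {..<i}" by auto
  then have "(\<Prod>l<i. of_nat a - of_nat l) = (0 :: rat)" by (intro prod_zero) auto
  then show ?thesis using False by simp
qed

text \<open>The entry is \<open>(\<Prod>l<i. 2 j + 1 - l) / (2 j + 1)!\<close>, also where it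
  vanishes. Expanding the numerator in falling factorials of \<open>j\<close> factors the matrix
  into a lower triangular one with diagonal \<open>2^i\<close> and an upper triangular one with
  diagonal \<open>i! / (2 i + 1)!\<close>.\<close>

lemma det_inverse_factorials:
  "det (mat n n (\<lambda>(i, j). if i \<le> 2 * j + 1 then 1 / fact (2 * j + 1 - i) else (0 :: rat)))
    = 2 ^ (n choose 2) * (\<Prod>i<n. fact i / fact (2 * i + 1))"
    (is "det ?A = _")
proof -
  define L where "L = mat n n (\<lambda>(i, k). falling_coeff i k)"
  define R where "R = mat n n (\<lambda>(k, j). (\<Prod>l<k. rat_of_nat j - of_nat l) / fact (2 * j + 1))"
  have "?A = L * R"
  proof (rule eq_matI)
    fix i j assume "i < dim_row (L * R)" "j < dim_col (L * R)"
    then have ij: "i < n" "j < n" by (auto simp: L_def R_def)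
    have "(L * R) $$ (i, j) = (\<Sum>k<n. falling_coeff i k * (\<Prod>l<k. rat_of_nat j - of_nat l)) / fact (2 * j + 1)"
      using ij by (simp add: L_def R_def scalar_prod_def lessThan_atLeast0 sum_divide_distrib)
    also have "(\<Sum>k<n. falling_coeff i k * (\<Prod>l<k. rat_of_nat j - of_nat l))
        = (\<Sum>k\<le>i. falling_coeff i k * (\<Prod>l<k. rat_of_nat j - of_nat l))"
      using ij by (intro sum.mono_neutral_right) (auto simp: falling_coeff_eq_0)
    also have "\<dots> = (\<Prod>l<i. rat_of_nat (2 * j + 1) - of_nat l)"
      unfolding falling_coeff_sum by (simp add: add.commute)
    also have "\<dots> / fact (2 * j + 1) = ?A $$ (i, j)"
      unfolding prod_falling_eq_fact using ij by (simp del: fact_Suc)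
    finally show "?A $$ (i, j) = (L * R) $$ (i, j)" ..
  qed (auto simp: L_def R_def)
  moreover have "det L = 2 ^ (n choose 2)"
  proof -
    have "det L = prod_list (diag_mat L)"
      by (rule det_lower_triangular[of n]) (auto simp: L_def falling_coeff_eq_0)
    also have "\<dots> = 2 ^ (\<Sum>i=0..<n. i)"
      by (simp add: prod_list_diag_prod L_def falling_coeff_diag power_sum)
    also have "(\<Sum>i=0..<n. i) = n choose 2"
      by (simp add: gauss_sum_nat choose_two Sum_Ico_nat)
    finally show ?thesis .
  qed
  moreover have "det R = (\<Prod>i<n. fact i / fact (2 * i + 1))"
  proof -
    have "det R = prod_list (diag_mat R)"
      by (rule det_upper_triangular[of _ n])
        (auto simp: R_def prod_falling_eq_fact simp del: fact_Suc)
    also have "\<dots> = (\<Prod>i=0..<n. (\<Prod>l<i. rat_of_nat i - of_nat l) / fact (2 * i + 1))"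
      by (simp add: prod_list_diag_prod R_def del: fact_Suc)
    also have "\<dots> = (\<Prod>i<n. fact i / fact (2 * i + 1))"
      by (simp add: prod_falling_eq_fact atLeast0LessThan del: fact_Suc)
    finally show ?thesis .
  qed
  ultimately show ?thesis by (simp add: det_mult[of _ n] L_def R_def)
qed

lemma pochhammer_linear_poly:
  fixes c :: "'a::{comm_ring_1,ring_no_zero_divisors}"
  shows "degree (pochhammer [:c, 1:] k) = k" "coeff (pochhammer [:c, 1:] k) k = 1"
proof -
  have "degree (pochhammer [:c, 1:] k) = k \<and> coeff (pochhammer [:c, 1:] k) k = 1"
  proof (induction k)
    case (Suc k)
    have lin: "[:c, 1:] + of_nat k = [:c + of_nat k, 1:]" by (simp add: of_nat_poly)
    have nz: "pochhammer [:c, 1:] k \<noteq> 0" using Suc by auto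
    show ?case unfolding pochhammer_Suc lin
    proof
      show "degree (pochhammer [:c, 1:] k * [:c + of_nat k, 1:]) = Suc k"
        using Suc nz by (subst degree_mult_eq) auto
      show "coeff (pochhammer [:c, 1:] k * [:c + of_nat k, 1:]) (Suc k) = 1"
        using Suc coeff_mult_top[of "pochhammer [:c, 1:] k" k "[:c + of_nat k, 1:]" 1] by simp
    qed
  qed simp
  then show "degree (pochhammer [:c, 1:] k) = k" "coeff (pochhammer [:c, 1:] k) k = 1" by auto
qed

lemma G_power_nth: "k \<le> i \<Longrightarrow> G ^ i $ k = of_bool (k = i)"
  by (auto simp: G_def power_mult_distrib fps_X_power_mult_nth fps_power_zeroth)

text \<open>Multiplying row \<open>i\<close> by the \<open>i\<close>-th power of the variable makes the degree bound depend on
  the column only.\<close>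
lemma top_coeff_det_poly_mat:
  fixes n :: nat
  defines "N \<equiv> (\<Sum>j<n. 2 * j + 1) - (\<Sum>i<n. i)"
  shows "degree (det (poly_mat n)) \<le> N"
    and "coeff (det (poly_mat n)) N = 2 ^ (n choose 2) * (\<Prod>i<n. fact i / fact (2 * i + 1))"
proof -
  define s where "s = (\<Sum>i<n. i)"
  define T :: "rat poly mat" where "T = mat n n (\<lambda>(i, j). if i = j then monom 1 i else 0)"
  have T: "T \<in> carrier_mat n n" by (simp add: T_def)
  have TA: "(T * poly_mat n) $$ (i, j) = monom 1 i * poly_mat n $$ (i, j)" if "i < n" "j < n" for i j
    using that carrier_matD[OF poly_mat_carrier[of n]]
    by (simp add: T_def scalar_prod_def if_distrib[of "\<lambda>x. x * _"] cong: if_cong)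
  \<comment> \<open>The series \<open>G ^ i\<close> starts with \<open>t^i\<close>, so the
    convolution starts at \<open>k = i\<close>.\<close>
  have entry: "poly_mat n $$ (i, j) = (\<Sum>k\<in>{i..2*j+1}.
     smult (G ^ i $ k / fact (2 * j + 1 - k)) (pochhammer [:1, 1:] (2 * j + 1 - k)))"
    if "i < n" "j < n" for i j
  proof -
    have "poly_mat n $$ (i, j) = (\<Sum>k=0..2*j+1.
       smult (G ^ i $ k / fact (2 * j + 1 - k)) (pochhammer [:1, 1:] (2 * j + 1 - k)))"
      using that by (simp only: poly_mat_def index_mat case_prod_conv)
    also have "\<dots> = (\<Sum>k\<in>{i..2*j+1}.
       smult (G ^ i $ k / fact (2 * j + 1 - k)) (pochhammer [:1, 1:] (2 * j + 1 - k)))"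
      by (intro sum.mono_neutral_right) (auto simp: G_power_nth)
    finally show ?thesis .
  qed
  have deg: "degree (poly_mat n $$ (i, j)) \<le> 2 * j + 1 - i" if "i < n" "j < n" for i j
    unfolding entry[OF that]
    by (intro degree_sum_le) (auto intro!: order.trans[OF degree_smult_le] simp: pochhammer_linear_poly)
  have zero: "poly_mat n $$ (i, j) = 0" if "i < n" "j < n" "2 * j + 1 < i" for i j
    unfolding entry[OF that(1,2)] using that by simp
  have lead: "coeff (poly_mat n $$ (i, j)) (2 * j + 1 - i) = 1 / fact (2 * j + 1 - i)"
    if "i < n" "j < n" "i \<le> 2 * j + 1" for i j
  proof -
    have "coeff (poly_mat n $$ (i, j)) (2 * j + 1 - i)
        = (\<Sum>k\<in>{i..2*j+1}. if k = i then 1 / fact (2 * j + 1 - i) else 0)"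
      unfolding entry[OF that(1,2)] coeff_sum
    proof (rule sum.cong)
      fix k assume k: "k \<in> {i..2*j+1}"
      show "coeff (smult (G ^ i $ k / fact (2 * j + 1 - k)) (pochhammer [:1, 1:] (2 * j + 1 - k))) (2 * j + 1 - i)
        = (if k = i then 1 / fact (2 * j + 1 - i) else 0)"
      proof (cases "k = i")
        case True
        then show ?thesis by (simp add: G_power_nth pochhammer_linear_poly del: fact_Suc)
      next
        case False
        then have "coeff (pochhammer [:1, 1 :: rat:] (2 * j + 1 - k)) (2 * j + 1 - i) = 0"
          using k by (intro coeff_eq_0) (simp add: pochhammer_linear_poly, arith)
        then show ?thesis using False by simp
      qed
    qed simp
    then show ?thesis using that by simp
  qed
  have lead': "coeff (poly_mat n $$ (i, j)) (Suc (2 * j) - i) = 1 / fact (Suc (2 * j) - i)"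
    if "i < n" "j < n" "i \<le> Suc (2 * j)" for i j
    using lead[OF that(1,2)] that(3) by (simp del: fact_Suc)
  have degTA: "degree ((T * poly_mat n) $$ (i, j)) \<le> 2 * j + 1" if "i < n" "j < n" for i j
  proof (cases "i \<le> 2 * j + 1")
    case True
    have "degree (monom 1 i * poly_mat n $$ (i, j)) \<le> i + (2 * j + 1 - i)"
      using deg[OF that] by (intro order.trans[OF degree_mult_le] add_mono) (auto simp: degree_monom_eq)
    then show ?thesis using True that by (simp add: TA)
  qed (use zero that in \<open>simp add: TA\<close>)
  have TAc: "T * poly_mat n \<in> carrier_mat n n" using T poly_mat_carrier by (rule mult_carrier_mat)
  have "det T = prod_list (diag_mat T)"
    by (rule det_upper_triangular[of _ n]) (auto simp: T_def)
  also have "\<dots> = (\<Prod>i<n. monom 1 i)"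
    by (simp add: prod_list_diag_prod T_def lessThan_atLeast0)
  also have "\<dots> = monom 1 s" unfolding s_def by (induction n) (auto simp: mult_monom add.commute)
  finally have det: "det (T * poly_mat n) = monom 1 s * det (poly_mat n)"
    using T by (simp add: det_mult[of _ n])
  note top = coeff_det_top[OF TAc, of "\<lambda>j. 2 * j + 1", OF degTA]
  \<comment> \<open>The row factors account for \<open>s\<close> of the total degree
    \<open>n^2\<close>, which leaves \<open>N = n (n + 1) / 2\<close>.\<close>
  have sN: "(\<Sum>j<n. 2 * j + 1) = s + N"
  proof -
    have "s \<le> (\<Sum>j<n. 2 * j + 1)" unfolding s_def by (rule sum_mono) simp
    then show ?thesis by (simp add: N_def s_def)
  qed
  show "degree (det (poly_mat n)) \<le> N"
  proof (cases "det (poly_mat n) = 0")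
    case False
    then have "degree (monom 1 s * det (poly_mat n)) = s + degree (det (poly_mat n))"
      by (subst degree_mult_eq) (auto simp: degree_monom_eq)
    then show ?thesis using top(1) unfolding det sN by simp
  qed simp
  have "coeff (det (poly_mat n)) N = coeff (det (T * poly_mat n)) (s + N)"
    unfolding det by (simp add: coeff_monom_mult)
  also have "\<dots> = det (mat n n (\<lambda>(i, j). coeff ((T * poly_mat n) $$ (i, j)) (2 * j + 1)))"
    using top(2) unfolding sN by simp
  also have "mat n n (\<lambda>(i, j). coeff ((T * poly_mat n) $$ (i, j)) (2 * j + 1))
      = mat n n (\<lambda>(i, j). if i \<le> 2 * j + 1 then 1 / fact (2 * j + 1 - i) else 0)"
    by (rule cong_mat) (auto simp: TA coeff_monom_mult lead' simp del: fact_Suc)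
  finally show "coeff (det (poly_mat n)) N = 2 ^ (n choose 2) * (\<Prod>i<n. fact i / fact (2 * i + 1))"
    unfolding det_inverse_factorials .
qed

section \<open>The product formula\<close>

lemma coprime_linear_polys:
  fixes a b :: "'a::field_gcd"
  assumes "a \<noteq> b"
  shows "coprime [:a, 1:] [:b, 1:]"
proof (rule coprimeI)
  fix d assume "d dvd [:a, 1:]" "d dvd [:b, 1:]"
  then have "d dvd [:a, 1:] - [:b, 1:]" by (rule dvd_diff)
  then have "d dvd [:a - b:]" by simp
  moreover have "is_unit [:a - b:]" using assms by (simp add: is_unit_const_poly_iff dvd_field_iff)
  ultimately show "is_unit d" using dvd_trans by blast
qed

lemma prod_coprime_dvd:
  fixes g :: "'i \<Rightarrow> 'a::semiring_gcd"
  assumes "finite M" "\<And>m m'. m \<in> M \<Longrightarrow> m' \<in> M \<Longrightarrow> m \<noteq> m' \<Longrightarrow> coprime (g m) (g m')"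
    and "\<And>m. m \<in> M \<Longrightarrow> g m dvd D"
  shows "prod g M dvd D"
  using assms
proof (induction M rule: finite_induct)
  case (insert m M)
  then have "coprime (g m) (prod g M)" by (intro prod_coprime_right) auto
  with insert show ?case by (simp add: divides_mult)
qed simp

text \<open>Regroups a product of Pochhammer symbols by linear factors, so that multiplicities can
  be read off.\<close>

lemma prod_prod_eq_prod_power_card:
  fixes f :: "'b \<Rightarrow> 'c::comm_monoid_mult"
  assumes "finite I" "finite M" "\<And>i. i \<in> I \<Longrightarrow> J i \<subseteq> M"
  shows "(\<Prod>i\<in>I. \<Prod>m\<in>J i. f m) = (\<Prod>m\<in>M. f m ^ card {i\<in>I. m \<in> J i})"
proof -
  have "(\<Prod>i\<in>I. \<Prod>m\<in>J i. f m) = (\<Prod>i\<in>I. \<Prod>m\<in>{m\<in>M. m \<in> J i}. f m)"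
    using assms(3) by (intro prod.cong) auto
  also have "\<dots> = (\<Prod>m\<in>M. \<Prod>i\<in>{i\<in>I. m \<in> J i}. f m)"
    using assms(1,2) by (rule prod.swap_restrict)
  finally show ?thesis by simp
qed

lemma pochhammer_linear_of_nat:
  "pochhammer [:of_nat s, 1:] k = (\<Prod>m\<in>{s..<s + k}. [:of_nat m, 1 :: 'a::comm_ring_1:])"
proof -
  have "pochhammer [:of_nat s, 1:] k = (\<Prod>i=0..<k. [:of_nat (s + i), 1 :: 'a:])"
    unfolding pochhammer_prod by (intro prod.cong) (auto simp: of_nat_poly)
  also have "\<dots> = (\<Prod>m\<in>{s..<s + k}. [:of_nat m, 1:])"
    using prod.shift_bounds_nat_ivl[of "\<lambda>m. [:of_nat m, 1 :: 'a:]" 0 s k] by (simp add: add.commute)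
  finally show ?thesis .
qed

text \<open>Its zeros are those found from left kernel vectors; the zeros of
  \<open>upper_factor\<close> come from right ones.\<close>

definition lower_factor :: "nat \<Rightarrow> rat poly" where
  "lower_factor n = (\<Prod>i=0..n div 2. pochhammer [:of_nat (4 * i + 1), 1:] (n - 2 * i))"

definition upper_factor :: "nat \<Rightarrow> rat poly" where
  "upper_factor n = (\<Prod>i=0..(n - 1) div 2. pochhammer [:of_nat (3 * n - 2 * i), 1:] (n - 2 * i - 1))"

lemma lower_factor_eq:
  "lower_factor n = (\<Prod>m\<in>{1..4*n}. [:of_nat m, 1:]
     ^ card {i. i < n \<and> even i \<and> 2 * i + 1 \<le> m \<and> m \<le> n + i})"
proof -
  have "lower_factor n = (\<Prod>i=0..n div 2. \<Prod>m\<in>{4*i+1..<4*i+1+(n-2*i)}. [:of_nat m, 1:])"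
    unfolding lower_factor_def pochhammer_linear_of_nat ..
  also have "\<dots> = (\<Prod>m\<in>{1..4*n}. [:of_nat m, 1:]
      ^ card {i\<in>{0..n div 2}. m \<in> {4*i+1..<4*i+1+(n-2*i)}})"
    by (rule prod_prod_eq_prod_power_card) auto
  also have "\<dots> = (\<Prod>m\<in>{1..4*n}. [:of_nat m, 1:]
     ^ card {i. i < n \<and> even i \<and> 2 * i + 1 \<le> m \<and> m \<le> n + i})"
  proof (intro prod.cong arg_cong2[of _ _ _ _ power] refl)
    fix m
    \<comment> \<open>The symbol with index \<open>i\<close> belongs to the kernel vector in the
      even row \<open>2 i\<close>: its range is \<open>2 (2 i) + 1 <= m <= n + 2 i\<close>.\<close>
    have "bij_betw (\<lambda>i. 2 * i) {i\<in>{0..n div 2}. m \<in> {4*i+1..<4*i+1+(n-2*i)}}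
        {i. i < n \<and> even i \<and> 2 * i + 1 \<le> m \<and> m \<le> n + i}"
      by (rule bij_betw_byWitness[of _ "\<lambda>i. i div 2"]) (auto elim!: evenE)
    then show "card {i\<in>{0..n div 2}. m \<in> {4*i+1..<4*i+1+(n-2*i)}}
        = card {i. i < n \<and> even i \<and> 2 * i + 1 \<le> m \<and> m \<le> n + i}"
      by (rule bij_betw_same_card)
  qed
  finally show ?thesis .
qed

lemma upper_factor_eq:
  assumes n: "n > 0"
  shows "upper_factor n = (\<Prod>m\<in>{1..4*n}. [:of_nat m, 1:]
     ^ card {r. r < n \<and> 2 * r + 2 + n \<le> m \<and> m \<le> 4 * r + 2})"
proof -
  have "upper_factor n = (\<Prod>i=0..(n-1) div 2.
      \<Prod>m\<in>{3*n-2*i..<3*n-2*i+(n-2*i-1)}. [:of_nat m, 1:])"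
    unfolding upper_factor_def pochhammer_linear_of_nat ..
  also have "\<dots> = (\<Prod>m\<in>{1..4*n}. [:of_nat m, 1:]
      ^ card {i\<in>{0..(n-1) div 2}. m \<in> {3*n-2*i..<3*n-2*i+(n-2*i-1)}})"
    using n by (intro prod_prod_eq_prod_power_card) auto
  also have "\<dots> = (\<Prod>m\<in>{1..4*n}. [:of_nat m, 1:]
     ^ card {r. r < n \<and> 2 * r + 2 + n \<le> m \<and> m \<le> 4 * r + 2})"
  proof (intro prod.cong arg_cong2[of _ _ _ _ power] refl)
    fix m
    \<comment> \<open>For \<open>r = n - 1 - i\<close> the first and last factors are at
      \<open>3 n - 2 i = 2 r + 2 + n\<close> and \<open>4 n - 4 i - 2 = 4 r + 2\<close>.\<close>
    have "bij_betw (\<lambda>i. n - 1 - i) {i\<in>{0..(n-1) div 2}. m \<in> {3*n-2*i..<3*n-2*i+(n-2*i-1)}}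
        {r. r < n \<and> 2 * r + 2 + n \<le> m \<and> m \<le> 4 * r + 2}"
      by (rule bij_betw_byWitness[of _ "\<lambda>r. n - 1 - r"]) (use n in auto)
    then show "card {i\<in>{0..(n-1) div 2}. m \<in> {3*n-2*i..<3*n-2*i+(n-2*i-1)}}
        = card {r. r < n \<and> 2 * r + 2 + n \<le> m \<and> m \<le> 4 * r + 2}"
      by (rule bij_betw_same_card)
  qed
  finally show ?thesis .
qed

lemma factors_dvd_det:
  assumes n: "n > 0"
  shows "lower_factor n * upper_factor n dvd det (poly_mat n)"
proof -
  define A where "A m = {i. i < n \<and> even i \<and> 2 * i + 1 \<le> m \<and> m \<le> n + i}" for m
  define B where "B m = {r. r < n \<and> 2 * r + 2 + n \<le> m \<and> m \<le> 4 * r + 2}" for m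
  have "lower_factor n * upper_factor n
      = (\<Prod>m\<in>{1..4*n}. [:of_nat m, 1:] ^ (card (A m) + card (B m)))"
    unfolding lower_factor_eq upper_factor_eq[OF n] A_def B_def
    by (simp add: power_add prod.distrib)
  also have "\<dots> dvd det (poly_mat n)"
  proof (rule prod_coprime_dvd)
    fix m :: nat assume m: "m \<in> {1..4*n}"
    \<comment> \<open>A member of \<open>A m\<close> forces \<open>m < 2 n\<close>, one of
      \<open>B m\<close> forces \<open>n <= 2 r\<close> and so \<open>m >= 2 n + 2\<close>. Hence
      left and right kernel vectors never have to be combined at the same zero.\<close>
    have "A m = {} \<or> B m = {}" by (auto simp: A_def B_def)
    moreover have "[:of_nat m, 1:] ^ card (A m) dvd det (poly_mat n)"
      unfolding A_def using m by (intro dvd_det_poly_mat_row) auto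
    moreover have "[:of_nat m, 1:] ^ card (B m) dvd det (poly_mat n)"
      unfolding B_def using m by (intro dvd_det_poly_mat_column) auto
    ultimately show "[:of_nat m, 1:] ^ (card (A m) + card (B m)) dvd det (poly_mat n)"
      by auto
  qed (auto intro!: coprime_power_left_iff[THEN iffD2] coprime_power_right_iff[THEN iffD2] coprime_linear_polys)
  finally show ?thesis .
qed

lemma monic_prod_pochhammer:
  fixes c :: "'i \<Rightarrow> 'a::{idom,ring_char_0}"
  assumes "finite I"
  shows "degree (\<Prod>i\<in>I. pochhammer [:c i, 1:] (k i)) = (\<Sum>i\<in>I. k i)"
    and "lead_coeff (\<Prod>i\<in>I. pochhammer [:c i, 1:] (k i)) = 1"
proof -
  have lc: "lead_coeff (pochhammer [:c i, 1:] (k i)) = 1" for i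
    using pochhammer_linear_poly[of "c i" "k i"] by simp
  have "pochhammer [:c i, 1:] (k i) \<noteq> 0" for i
    using lc[of i] by auto
  then show "degree (\<Prod>i\<in>I. pochhammer [:c i, 1:] (k i)) = (\<Sum>i\<in>I. k i)"
    by (subst degree_prod_eq_sum_degree) (auto simp: pochhammer_linear_poly)
  show "lead_coeff (\<Prod>i\<in>I. pochhammer [:c i, 1:] (k i)) = 1"
    unfolding lead_coeff_prod lc by simp
qed

text \<open>The two progressions are the numbers up to \<open>n + 1\<close> with the parity of
  \<open>n + 1\<close> and of \<open>n\<close>.\<close>

lemma sum_steps_of_two:
  "(\<Sum>i=0..Suc n div 2. Suc n - 2 * i) + (\<Sum>i=0..n div 2. n - 2 * i) = (\<Sum>i\<le>Suc n. i)"
proof (induction n)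
  case (Suc n)
  have "(\<Sum>i=0..Suc (Suc n) div 2. Suc (Suc n) - 2 * i)
      = Suc (Suc n) + (\<Sum>i=0..n div 2. n - 2 * i)"
    by (simp add: sum.atLeast0_atMost_Suc_shift del: sum.cl_ivl_Suc sum.atLeast0_atMost_Suc)
  with Suc show ?case by simp
qed simp

lemma degree_factors:
  fixes n :: nat
  assumes n: "n > 0"
  shows "(\<Sum>i=0..n div 2. n - 2 * i) + (\<Sum>i=0..(n - 1) div 2. n - 2 * i - 1)
    = (\<Sum>j<n. 2 * j + 1) - (\<Sum>i<n. i)"
proof -
  obtain p where p: "n = Suc p" using n by (cases n) auto
  have "n - 2 * i - 1 = p - 2 * i" for i using p by simp
  then have "(\<Sum>i=0..n div 2. n - 2 * i) + (\<Sum>i=0..(n - 1) div 2. n - 2 * i - 1) = (\<Sum>i\<le>Suc p. i)"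
    using sum_steps_of_two[of p] by (simp add: p)
  also have "\<dots> = (\<Sum>j<n. 2 * j + 1) - (\<Sum>i<n. i)"
  proof -
    have "(\<Sum>i\<le>n. i) + (\<Sum>i<n. i) = (\<Sum>j<n. 2 * j + 1)"
      by (induction n) auto
    then show ?thesis by (simp add: p)
  qed
  finally show ?thesis .
qed

text \<open>The known divisor is monic and its degree equals the degree bound \<open>N\<close> of
  the determinant, so the cofactor is a constant, namely the coefficient at
  \<open>N\<close>.\<close>

lemma det_poly_mat:
  assumes n: "n > 0"
  shows "det (poly_mat n) = smult (2 ^ (n choose 2) * (\<Prod>i<n. fact i / fact (2 * i + 1)))
    (lower_factor n * upper_factor n)"
proof -
  define F where "F = lower_factor n * upper_factor n"
  define c :: rat where "c = 2 ^ (n choose 2) * (\<Prod>i<n. fact i / fact (2 * i + 1))"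
  define N where "N = (\<Sum>j<n. 2 * j + 1) - (\<Sum>i<n. i)"
  have lc: "lead_coeff F = 1"
    unfolding F_def lead_coeff_mult lower_factor_def upper_factor_def
    by (simp only: monic_prod_pochhammer(2)[OF finite_atLeastAtMost])
  have "lower_factor n \<noteq> 0" "upper_factor n \<noteq> 0" using lc by (auto simp: F_def)
  then have degF: "degree F = N"
    unfolding F_def N_def degree_factors[OF n, symmetric]
    by (subst degree_mult_eq) (auto simp: lower_factor_def upper_factor_def monic_prod_pochhammer(1))
  obtain q where q: "det (poly_mat n) = F * q"
    using factors_dvd_det[OF n] by (auto simp: F_def elim: dvdE)
  have top: "degree (F * q) \<le> N" "coeff (F * q) N = c"
    using top_coeff_det_poly_mat[of n] unfolding q by (auto simp: N_def c_def)
  have "F \<noteq> 0" using lc by auto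
  have "degree q = 0"
  proof (cases "q = 0")
    case False
    then show ?thesis using top(1) degF \<open>F \<noteq> 0\<close> by (simp add: degree_mult_eq)
  qed simp
  then obtain d where d: "q = [:d:]" by (auto elim: degree_eq_zeroE)
  have "d = c" using top(2) lc by (simp add: d degF mult.commute)
  then show ?thesis by (simp add: q d F_def c_def)
qed

section \<open>Passage from rational values to the indeterminate\<close>

text \<open>One polynomial that specializes to \<open>D2 n x\<close> at rational \<open>x\<close>
  and maps to \<open>D2 n indet\<close> in the fraction field; it carries the formula from the
  former to the latter.\<close>

definition D2_poly :: "nat \<Rightarrow> rat poly" where
  "D2_poly n = det (mat n n (\<lambda>(i, j). smult (1 / fact (2 * j + 1))
     (2 ^ i * pochhammer [:1 + of_nat i, 1:] (2 * j + 1) + pochhammer [:1 - of_nat i, 1:] (2 * j + 1))))"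

lemma D2_pochhammer:
  "D2 n x = det (mat n n (\<lambda>(i, j). (1 / fact (2 * j + 1)) *
     (2 ^ i * pochhammer (x + 1 + of_nat i) (2 * j + 1) + pochhammer (x + 1 - of_nat i) (2 * j + 1))))"
  for x :: "'a::field_char_0"
proof -
  have 1: "(x + of_nat i + 2 * of_nat j + 1) gchoose (2 * j + 1)
      = pochhammer (x + 1 + of_nat i) (2 * j + 1) / fact (2 * j + 1)" for i j
    using gchoose_eq_pochhammer[of "x + of_nat i" "2 * j + 1"] by (simp add: algebra_simps)
  have 2: "(x - of_nat i + 2 * of_nat j + 1) gchoose (2 * j + 1)
      = pochhammer (x + 1 - of_nat i) (2 * j + 1) / fact (2 * j + 1)" for i j
    using gchoose_eq_pochhammer[of "x - of_nat i" "2 * j + 1"] by (simp add: algebra_simps)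
  show ?thesis unfolding D2_def 1 2
    by (intro arg_cong[of _ _ det] cong_mat) (auto simp: add_divide_distrib simp del: fact_Suc)
qed

lemma poly_D2_poly: "poly (D2_poly n) x = D2 n x"
  unfolding D2_poly_def poly_det D2_pochhammer
  by (intro arg_cong[of _ _ det] eq_matI) (auto simp: poly_pochhammer add_ac add_diff_eq simp del: fact_Suc)

interpretation fract_const: field_char_0_hom "\<lambda>c :: rat. to_fract [:c:]"
  by unfold_locales (auto simp: one_pCons simp flip: to_fract_1 to_fract_add to_fract_mult)

interpretation to_fract: comm_ring_hom "to_fract :: rat poly \<Rightarrow> rat poly fract"
  by unfold_locales auto

lemma to_fract_smult: "to_fract (smult c p) = to_fract [:c:] * to_fract p"
  by (simp flip: to_fract_mult)

lemma to_fract_pochhammer: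
  "to_fract (pochhammer p k) = pochhammer (to_fract p) k" for p :: "rat poly"
  by (simp add: pochhammer_prod to_fract.hom_prod to_fract.hom_of_nat)

lemma to_fract_linear: "to_fract [:c, 1:] = to_fract [:c:] + indet"
  by (simp add: indet_def flip: to_fract_add)

lemma fract_const_fact: "to_fract [:fact k :: rat:] = fact k"
  using fract_const.hom_of_nat[of "fact k"] by simp

lemma to_fract_D2_poly: "to_fract (D2_poly n) = D2 n indet"
  unfolding D2_poly_def D2_pochhammer to_fract.hom_det[symmetric]
  by (intro arg_cong[of _ _ det] eq_matI)
    (auto simp: to_fract_smult to_fract_pochhammer to_fract_linear to_fract.hom_power
      hom_distribs fract_const_fact add_ac add_diff_eq simp del: fact_Suc)

text \<open>Row reduction was carried out at rational numbers; polynomials that agree at all of them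
  are equal.\<close>

lemma D2_poly_eq:
  assumes n: "n > 0"
  shows "D2_poly n = smult (2 ^ ((n choose 2) + 1) * (\<Prod>i<n. fact i / fact (2 * i + 1)))
    (lower_factor n * upper_factor n)"
proof -
  have "poly (D2_poly n) x = poly (smult 2 (det (poly_mat n))) x" for x
    using D2_eq_red_mat[OF n] by (simp add: poly_D2_poly poly_det_poly_mat)
  then have "D2_poly n = smult 2 (det (poly_mat n))" by (simp add: poly_eq_poly_eq_iff[symmetric] fun_eq_iff)
  then show ?thesis by (simp add: det_poly_mat[OF n] mult.assoc)
qed

lemma D2_indet_product:
  assumes n: "n > 0"
  defines "x \<equiv> indet"
  shows "D2 n x = 2 ^ ((n choose 2) + 1)
           * (\<Prod>i = 0..n - 1. fact i / fact (2 * i + 1))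
           * (\<Prod>i = 0..n div 2. pochhammer (x + 4 * of_nat i + 1) (n - 2 * i))
           * (\<Prod>i = 0..(n - 1) div 2. pochhammer (x - 2 * of_nat i + 3 * of_nat n) (n - 2 * i - 1))"
proof -
  have const: "to_fract [:2 ^ ((n choose 2) + 1) * (\<Prod>i<n. fact i / fact (2 * i + 1 :: nat)) :: rat:]
      = 2 ^ ((n choose 2) + 1) * (\<Prod>i = 0..n - 1. fact i / fact (2 * i + 1))"
  proof -
    have "{..<n} = {0..n - 1}" using n by auto
    then show ?thesis
      by (simp add: hom_distribs fract_const_fact del: fact_Suc)
  qed
  have "to_fract (lower_factor n) = (\<Prod>i = 0..n div 2. pochhammer (x + 4 * of_nat i + 1) (n - 2 * i))"
    unfolding lower_factor_def to_fract.hom_prod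
    by (simp add: to_fract_pochhammer to_fract_linear x_def hom_distribs add_ac)
  moreover have "to_fract (upper_factor n)
      = (\<Prod>i = 0..(n - 1) div 2. pochhammer (x - 2 * of_nat i + 3 * of_nat n) (n - 2 * i - 1))"
    unfolding upper_factor_def to_fract.hom_prod
  proof (rule prod.cong)
    fix i assume i: "i \<in> {0..(n - 1) div 2}"
    then have "2 * i \<le> 3 * n" by auto
    then have "to_fract [:of_nat (3 * n - 2 * i), 1:] = x - 2 * of_nat i + 3 * of_nat n"
      unfolding to_fract_linear fract_const.hom_of_nat by (simp add: of_nat_diff x_def)
    then show "to_fract (pochhammer [:of_nat (3 * n - 2 * i), 1:] (n - 2 * i - 1))
        = pochhammer (x - 2 * of_nat i + 3 * of_nat n) (n - 2 * i - 1)"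
      by (simp add: to_fract_pochhammer)
  qed simp
  ultimately show ?thesis
    unfolding x_def to_fract_D2_poly[symmetric] D2_poly_eq[OF n] to_fract_smult const
    by (simp add: mult.assoc)
qed

section \<open>The formula with Gamma quotients\<close>

text \<open>The symbol \<open>2^k (a/2)_k\<close>, written without halves.\<close>

definition step_prod :: "'a::comm_ring_1 \<Rightarrow> nat \<Rightarrow> 'a" where
  "step_prod a k = (\<Prod>i<k. a + 2 * of_nat i)"

lemma step_prod_0 [simp]: "step_prod a 0 = 1"
  and step_prod_Suc: "step_prod a (Suc k) = step_prod a k * (a + 2 * of_nat k)"
  by (simp_all add: step_prod_def)

lemma step_prod_Suc': "step_prod a (Suc k) = a * step_prod (a + 2) k"
  by (simp add: step_prod_def prod.lessThan_Suc_shift add_ac del: prod.lessThan_Suc)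

lemma step_prod_add: "step_prod a (j + k) = step_prod a j * step_prod (a + 2 * of_nat j) k"
  by (induction k) (simp_all add: step_prod_Suc algebra_simps)

lemma pochhammer_double_step: "pochhammer a (2 * k) = step_prod a k * step_prod (a + 1) k"
  by (induction k) (simp_all add: step_prod_Suc pochhammer_Suc algebra_simps)

lemma step_prod_down: "(\<Prod>l<k. y - 2 * of_nat l) = step_prod (y + 2 - 2 * of_nat k) k"
proof (induction k)
  case (Suc k)
  then show ?case
    by (simp add: step_prod_Suc' mult.commute algebra_simps)
qed simp

lemma step_prod_half: "2 ^ k * pochhammer (a / 2) k = step_prod a k" for a :: "'a::field_char_0"
  by (induction k) (simp_all add: step_prod_Suc pochhammer_Suc field_simps)

text \<open>This is what remains to be checked in the step from \<open>n\<close> to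
  \<open>n + 1\<close>. The Pochhammer symbol splits into two progressions of step 2. One extends
  the first \<open>step_prod\<close> up to the factor \<open>x + 3 n + 1\<close>; the other is the
  product on the right together with \<open>x + 3 n + 2\<close>.\<close>

lemma factor_ratio_identity:
  fixes x :: "'a::comm_ring_1"
  shows "step_prod (x + of_nat n + 1) (Suc (n div 2)) * pochhammer (x + 2 * of_nat n + 2) (n + 1)
    = (x + 3 * of_nat n + 1) * (x + 3 * of_nat n + 2) * step_prod (x + of_nat n + 1) n
      * (\<Prod>l<n div 2. x + 3 * of_nat n - 2 * of_nat l)"
proof (cases "even n")
  case True
  then obtain k where n: "n = 2 * k" by (elim evenE)
  have 1: "pochhammer (x + 2 * of_nat n + 2) (n + 1)
      = step_prod (x + 4 * of_nat k + 2) (Suc k) * step_prod (x + 4 * of_nat k + 3) k"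
  proof -
    have "x + 2 * of_nat n + 2 = x + 4 * of_nat k + 2" "x + 4 * of_nat k + 2 + 1 = x + 4 * of_nat k + 3"
      by (simp_all add: n)
    then show ?thesis
      using pochhammer_double_step[of "x + 4 * of_nat k + 2" k]
      by (simp add: n pochhammer_Suc step_prod_Suc mult_ac add_ac)
  qed
  have 2: "(\<Prod>l<n div 2. x + 3 * of_nat n - 2 * of_nat l) = step_prod (x + 4 * of_nat k + 2) k"
    unfolding step_prod_down by (simp add: n algebra_simps)
  have 3: "step_prod (x + of_nat n + 1) n * (x + 3 * of_nat n + 1)
      = step_prod (x + of_nat n + 1) (Suc k + k)"
  proof -
    have "Suc k + k = Suc n" by (simp add: n)
    then show ?thesis by (simp add: step_prod_Suc algebra_simps)
  qed
  have 4: "step_prod (x + of_nat n + 1) (Suc k + k)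
      = step_prod (x + of_nat n + 1) (Suc k) * step_prod (x + 4 * of_nat k + 3) k"
    unfolding step_prod_add by (simp add: n algebra_simps)
  have 5: "step_prod (x + 4 * of_nat k + 2) (Suc k)
      = step_prod (x + 4 * of_nat k + 2) k * (x + 3 * of_nat n + 2)"
    by (simp add: step_prod_Suc n algebra_simps)
  have "n div 2 = k" by (simp add: n)
  have "(x + 3 * of_nat n + 1) * (x + 3 * of_nat n + 2) * step_prod (x + of_nat n + 1) n
        * (\<Prod>l<n div 2. x + 3 * of_nat n - 2 * of_nat l)
      = (step_prod (x + of_nat n + 1) n * (x + 3 * of_nat n + 1)) * (x + 3 * of_nat n + 2)
        * (\<Prod>l<n div 2. x + 3 * of_nat n - 2 * of_nat l)"
    by (simp only: mult_ac)
  also have "\<dots> = step_prod (x + of_nat n + 1) (Suc k) * step_prod (x + 4 * of_nat k + 3) k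
      * (x + 3 * of_nat n + 2) * step_prod (x + 4 * of_nat k + 2) k"
    by (simp only: 3 4 2)
  also have "\<dots> = step_prod (x + of_nat n + 1) (Suc k) * pochhammer (x + 2 * of_nat n + 2) (n + 1)"
    unfolding 1 5 by (simp only: mult_ac)
  finally show ?thesis using \<open>n div 2 = k\<close> by (simp only:)
next
  case False
  then obtain k where n: "n = 2 * k + 1" by (elim oddE)
  have 1: "pochhammer (x + 2 * of_nat n + 2) (n + 1)
      = step_prod (x + 4 * of_nat k + 4) (Suc k) * step_prod (x + 4 * of_nat k + 5) (Suc k)"
    using pochhammer_double_step[of "x + 4 * of_nat k + 4" "Suc k"] by (simp add: n algebra_simps)
  have 2: "(\<Prod>l<n div 2. x + 3 * of_nat n - 2 * of_nat l) = step_prod (x + 4 * of_nat k + 5) k"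
    unfolding step_prod_down by (simp add: n algebra_simps)
  have 3: "step_prod (x + of_nat n + 1) n * (x + 3 * of_nat n + 1)
      = step_prod (x + of_nat n + 1) (Suc k + Suc k)"
  proof -
    have "Suc k + Suc k = Suc n" by (simp add: n)
    then show ?thesis by (simp add: step_prod_Suc algebra_simps)
  qed
  have 4: "step_prod (x + of_nat n + 1) (Suc k + Suc k)
      = step_prod (x + of_nat n + 1) (Suc k) * step_prod (x + 4 * of_nat k + 4) (Suc k)"
    unfolding step_prod_add by (simp add: n algebra_simps)
  have 5: "step_prod (x + 4 * of_nat k + 5) (Suc k)
      = step_prod (x + 4 * of_nat k + 5) k * (x + 3 * of_nat n + 2)"
    by (simp add: step_prod_Suc n algebra_simps)
  have "n div 2 = k" by (simp add: n)
  have "(x + 3 * of_nat n + 1) * (x + 3 * of_nat n + 2) * step_prod (x + of_nat n + 1) n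
        * (\<Prod>l<n div 2. x + 3 * of_nat n - 2 * of_nat l)
      = (step_prod (x + of_nat n + 1) n * (x + 3 * of_nat n + 1)) * (x + 3 * of_nat n + 2)
        * (\<Prod>l<n div 2. x + 3 * of_nat n - 2 * of_nat l)"
    by (simp only: mult_ac)
  also have "\<dots> = step_prod (x + of_nat n + 1) (Suc k) * step_prod (x + 4 * of_nat k + 4) (Suc k)
      * (x + 3 * of_nat n + 2) * step_prod (x + 4 * of_nat k + 5) k"
    by (simp only: 3 4 2)
  also have "\<dots> = step_prod (x + of_nat n + 1) (Suc k) * pochhammer (x + 2 * of_nat n + 2) (n + 1)"
    unfolding 1 5 by (simp only: mult_ac)
  finally show ?thesis using \<open>n div 2 = k\<close> by (simp only:)
qed

definition lower_prod :: "'a::comm_ring_1 \<Rightarrow> nat \<Rightarrow> 'a" where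
  "lower_prod x n = (\<Prod>i = 0..n div 2. pochhammer (x + 4 * of_nat i + 1) (n - 2 * i))"

definition upper_prod :: "'a::comm_ring_1 \<Rightarrow> nat \<Rightarrow> 'a" where
  "upper_prod x n = (\<Prod>i = 0..(n - 1) div 2. pochhammer (x - 2 * of_nat i + 3 * of_nat n) (n - 2 * i - 1))"

text \<open>Each symbol gains the factor \<open>x + n + 1 + 2 i\<close> at its top. The additional
  index for odd \<open>n\<close> contributes an empty symbol.\<close>

lemma lower_prod_Suc:
  "lower_prod x (Suc n) = lower_prod x n * step_prod (x + of_nat n + 1) (Suc (n div 2))"
proof -
  have "lower_prod x (Suc n) = (\<Prod>i = 0..n div 2. pochhammer (x + 4 * of_nat i + 1) (Suc n - 2 * i))"
    unfolding lower_prod_def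
  proof (rule prod.mono_neutral_right)
    show "\<forall>i\<in>{0..Suc n div 2} - {0..n div 2}. pochhammer (x + 4 * of_nat i + 1) (Suc n - 2 * i) = 1"
    proof
      fix i assume "i \<in> {0..Suc n div 2} - {0..n div 2}"
      then have "Suc n - 2 * i = 0" by auto
      then show "pochhammer (x + 4 * of_nat i + 1) (Suc n - 2 * i) = 1" by (simp only: pochhammer_0)
    qed
  qed auto
  also have "\<dots> = (\<Prod>i = 0..n div 2. pochhammer (x + 4 * of_nat i + 1) (n - 2 * i)
      * (x + of_nat n + 1 + 2 * of_nat i))"
  proof (rule prod.cong)
    fix i assume i: "i \<in> {0..n div 2}"
    then have "Suc n - 2 * i = Suc (n - 2 * i)" "2 * i \<le> n" by auto
    then show "pochhammer (x + 4 * of_nat i + 1) (Suc n - 2 * i)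
        = pochhammer (x + 4 * of_nat i + 1) (n - 2 * i) * (x + of_nat n + 1 + 2 * of_nat i)"
      by (simp add: pochhammer_Suc of_nat_diff algebra_simps)
  qed simp
  also have "\<dots> = lower_prod x n * step_prod (x + of_nat n + 1) (Suc (n div 2))"
    by (simp add: prod.distrib lower_prod_def step_prod_def atLeast0AtMost flip: lessThan_Suc_atMost
        del: prod.lessThan_Suc)
  finally show ?thesis .
qed

text \<open>The symbol \<open>l + 1\<close> for \<open>n + 1\<close> is the symbol \<open>l\<close>
  for \<open>n\<close> without its lowest factor \<open>x + 3 n - 2 l\<close>; the symbol 0 for
  \<open>n + 1\<close> is new.\<close>

lemma upper_prod_Suc:
  "upper_prod x (Suc n) * (\<Prod>l<n div 2. x + 3 * of_nat n - 2 * of_nat l)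
    = upper_prod x n * pochhammer (x + 3 * of_nat n + 3) n"
proof -
  define b where "b n i = pochhammer (x - 2 * of_nat i + 3 * of_nat n) (n - 2 * i - 1)" for n i :: nat
  have "upper_prod x (Suc n) = b (Suc n) 0 * (\<Prod>l<n div 2. b (Suc n) (Suc l))"
    by (simp add: upper_prod_def b_def atLeast0AtMost prod.lessThan_Suc_shift
        flip: lessThan_Suc_atMost del: prod.lessThan_Suc)
  moreover have "(\<Prod>l<n div 2. b (Suc n) (Suc l)) * (\<Prod>l<n div 2. x + 3 * of_nat n - 2 * of_nat l)
      = (\<Prod>l<n div 2. b n l)"
    unfolding prod.distrib[symmetric]
  proof (rule prod.cong)
    fix l assume "l \<in> {..<n div 2}"
    then have "n - 2 * l - 1 = Suc (Suc n - 2 * Suc l - 1)" by auto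
    then show "b (Suc n) (Suc l) * (x + 3 * of_nat n - 2 * of_nat l) = b n l"
      by (simp add: b_def pochhammer_rec algebra_simps)
  qed simp
  moreover have "(\<Prod>l<n div 2. b n l) = upper_prod x n"
    unfolding upper_prod_def b_def[symmetric]
  proof (rule prod.mono_neutral_left)
    show "\<forall>i\<in>{0..(n - 1) div 2} - {..<n div 2}. b n i = 1"
    proof
      fix i assume "i \<in> {0..(n - 1) div 2} - {..<n div 2}"
      then have "n - 2 * i - 1 = 0" by auto
      then show "b n i = 1" by (simp only: b_def pochhammer_0)
    qed
  qed auto
  moreover have "b (Suc n) 0 = pochhammer (x + 3 * of_nat n + 3) n"
    by (simp add: b_def algebra_simps)
  ultimately show ?thesis by (simp only: mult.assoc) (simp only: mult.commute)
qed

text \<open>The differences of the arguments are \<open>n + 1\<close>, \<open>n + 1\<close>,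
  \<open>n + 2\<close> and \<open>n\<close>. Two factors are split off the third quotient to match
  \<open>factor_ratio_identity\<close>.\<close>

lemma Gamma_quots_Suc:
  fixes x :: "'a::field_char_0"
  shows "Gamma_quot (of_nat (Suc n)) (of_nat (2 * Suc n)) = (fact n / fact (2 * n + 1) :: 'a)"
    and "Gamma_quot (2 * of_nat (Suc n) + x) (3 * of_nat (Suc n) + x)
      = 1 / pochhammer (x + 2 * of_nat n + 2) (n + 1)"
    and "Gamma_quot (4 * of_nat (Suc n) + x - 1) (3 * of_nat (Suc n) + x - 2)
      = (x + 3 * of_nat n + 1) * (x + 3 * of_nat n + 2) * pochhammer (x + 3 * of_nat n + 3) n"
    and "Gamma_quot ((3 * of_nat (Suc n) + x - 2) / 2) ((of_nat (Suc n) + x) / 2)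
      = step_prod (x + of_nat n + 1) n / 2 ^ n"
proof -
  have "(of_nat (2 * Suc n) :: 'a) = of_nat (Suc n) + of_nat (Suc n)" by simp
  then have "Gamma_quot (of_nat (Suc n)) (of_nat (2 * Suc n)) = 1 / pochhammer (of_nat (Suc n) :: 'a) (Suc n)"
    by (simp only: Gamma_quot_minus)
  moreover have "(fact (2 * n + 1) :: 'a) = fact n * pochhammer (of_nat (Suc n)) (Suc n)"
    using pochhammer_product'[of "1 :: 'a" n "Suc n"]
    by (simp add: pochhammer_fact mult_2 add_ac del: fact_Suc)
  ultimately show "Gamma_quot (of_nat (Suc n)) (of_nat (2 * Suc n)) = (fact n / fact (2 * n + 1) :: 'a)"
    by (simp del: fact_Suc)
next
  have "3 * of_nat (Suc n) + x = 2 * of_nat (Suc n) + x + of_nat (Suc n)" by simp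
  then show "Gamma_quot (2 * of_nat (Suc n) + x) (3 * of_nat (Suc n) + x)
      = 1 / pochhammer (x + 2 * of_nat n + 2) (n + 1)"
    by (simp only: Gamma_quot_minus) (simp add: algebra_simps)
next
  have "4 * of_nat (Suc n) + x - 1 = 3 * of_nat (Suc n) + x - 2 + of_nat (n + 2)" by simp
  then have "Gamma_quot (4 * of_nat (Suc n) + x - 1) (3 * of_nat (Suc n) + x - 2)
      = pochhammer (3 * of_nat (Suc n) + x - 2) (n + 2)"
    by (simp only: Gamma_quot_plus)
  then show "Gamma_quot (4 * of_nat (Suc n) + x - 1) (3 * of_nat (Suc n) + x - 2)
      = (x + 3 * of_nat n + 1) * (x + 3 * of_nat n + 2) * pochhammer (x + 3 * of_nat n + 3) n"
    by (simp add: pochhammer_rec algebra_simps)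
next
  have "(3 * of_nat (Suc n) + x - 2) / 2 = (of_nat (Suc n) + x) / 2 + of_nat n"
    by (simp add: field_simps)
  then have "Gamma_quot ((3 * of_nat (Suc n) + x - 2) / 2) ((of_nat (Suc n) + x) / 2)
      = pochhammer ((of_nat (Suc n) + x) / 2) n"
    by (simp only: Gamma_quot_plus)
  also have "\<dots> = step_prod (of_nat (Suc n) + x) n / 2 ^ n"
    by (simp flip: step_prod_half)
  finally show "Gamma_quot ((3 * of_nat (Suc n) + x - 2) / 2) ((of_nat (Suc n) + x) / 2)
      = step_prod (x + of_nat n + 1) n / 2 ^ n"
    by (simp add: add_ac)
qed

text \<open>By induction, comparing the ratios of consecutive products. The assumption on
  \<open>x\<close> keeps the denominators \<open>Q\<close> and \<open>R\<close> away from
  zero.\<close>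

lemma product_eq_Gamma_product:
  fixes x :: "'a::field_char_0"
  assumes x: "\<And>k :: nat. x + of_nat k \<noteq> 0"
  shows "2 ^ ((n choose 2) + 1) * (\<Prod>i<n. fact i / fact (2 * i + 1)) * lower_prod x n * upper_prod x n
    = 2 * (\<Prod>i = 1..n. 2 ^ (2 * i - 2)
             * Gamma_quot (of_nat i) (of_nat (2 * i))
             * Gamma_quot (2 * of_nat i + x) (3 * of_nat i + x)
             * Gamma_quot (4 * of_nat i + x - 1) (3 * of_nat i + x - 2)
             * Gamma_quot ((3 * of_nat i + x - 2) / 2) ((of_nat i + x) / 2))"
    (is "?P n = 2 * (\<Prod>i = 1..n. ?g i)")
proof (induction n)
  case 0
  show ?case by (simp add: lower_prod_def upper_prod_def binomial_eq_0)
next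
  case (Suc n)
  define E where "E = step_prod (x + of_nat n + 1) (Suc (n div 2))"
  define Q where "Q = (\<Prod>l<n div 2. x + 3 * of_nat n - 2 * of_nat l)"
  define R where "R = pochhammer (x + 2 * of_nat n + 2) (n + 1)"
  define T where "T = pochhammer (x + 3 * of_nat n + 3) n"
  define S where "S = step_prod (x + of_nat n + 1) n"
  define c where "c = (x + 3 * of_nat n + 1) * (x + 3 * of_nat n + 2)"
  have Q: "Q \<noteq> 0"
  proof -
    have "x + 3 * of_nat n - 2 * of_nat l \<noteq> 0" if "l < n div 2" for l
      using x[of "3 * n - 2 * l"] that by (simp add: of_nat_diff add_diff_eq)
    then show ?thesis by (simp add: Q_def)
  qed
  have R: "R \<noteq> 0"
  proof
    assume "R = 0"
    then obtain k where "x + 2 * of_nat n + 2 = - of_nat k"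
      by (auto simp: R_def pochhammer_eq_0_iff)
    then have "x + of_nat (2 * n + 2 + k) = 0" by (simp add: eq_neg_iff_add_eq_0 add_ac)
    with x show False by blast
  qed
  have id: "E * R = c * S * Q"
    unfolding E_def R_def c_def S_def Q_def by (rule factor_ratio_identity)
  have u: "upper_prod x (Suc n) = upper_prod x n * T / Q"
    using upper_prod_Suc[of x n] Q by (simp add: Q_def T_def field_simps)
  have E: "E = c * S * Q / R" using id R by (simp add: field_simps)
  have choose: "Suc n choose 2 = (n choose 2) + n" by (simp add: numeral_2_eq_2)
  \<comment> \<open>One factor \<open>2^n\<close> is the growth of \<open>2^(n choose 2)\<close>,
    the other cancels the denominator from the Gamma quotient with half arguments.\<close>
  have "2 * Suc n - 2 = n + n" by simp
  then have pow: "2 ^ (2 * Suc n - 2) = (2 ^ n * 2 ^ n :: 'a)" by (simp only: power_add)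
  have g: "?g (Suc n) = 2 ^ n * (fact n / fact (2 * n + 1)) * (1 / R) * (c * T) * S"
    unfolding Gamma_quots_Suc R_def[symmetric] T_def[symmetric] S_def[symmetric] c_def[symmetric] pow
    by (simp del: fact_Suc)
  have "?P (Suc n) = ?P n * (2 ^ n * (fact n / fact (2 * n + 1))) * (E * T / Q)"
    unfolding u lower_prod_Suc E_def[symmetric] choose
    by (simp add: power_add)
  also have "\<dots> = ?P n * ?g (Suc n)"
    unfolding g unfolding E using Q by simp
  finally show ?case using Suc by (simp add: mult_ac)
qed

theorem theorem6:
  fixes n :: nat and x :: "rat poly fract"
  assumes "n > 0" and "x = indet"
  shows "D2 n x =
           2 ^ ((n choose 2) + 1)
           * (\<Prod>i = 0..n - 1. fact i / fact (2 * i + 1))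
           * (\<Prod>i = 0..n div 2. pochhammer (x + 4 * of_nat i + 1) (n - 2 * i))
           * (\<Prod>i = 0..(n - 1) div 2. pochhammer (x - 2 * of_nat i + 3 * of_nat n) (n - 2 * i - 1))
       \<and> D2 n x =
           2 * (\<Prod>i = 1..n. 2 ^ (2 * i - 2)
             * Gamma_quot (of_nat i) (of_nat (2 * i))
             * Gamma_quot (2 * of_nat i + x) (3 * of_nat i + x)
             * Gamma_quot (4 * of_nat i + x - 1) (3 * of_nat i + x - 2)
             * Gamma_quot ((3 * of_nat i + x - 2) / 2) ((of_nat i + x) / 2))"
proof -
  \<comment> \<open>The indeterminate avoids all negative integers, being the image of a linear
    polynomial under an injective map.\<close>
  have "x + of_nat k \<noteq> 0" for k :: nat
  proof -
    have "x + of_nat k = to_fract [:of_nat k, 1:]"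
      unfolding to_fract_linear fract_const.hom_of_nat by (simp add: assms)
    then show ?thesis by simp
  qed
  note Gamma = product_eq_Gamma_product[OF this, of n, unfolded lower_prod_def upper_prod_def]
  note prod = D2_indet_product[OF assms(1), folded assms(2)]
  have "{..<n} = {0..n - 1}" using assms(1) by auto
  from conjI[OF prod trans[OF prod Gamma[unfolded this]]] show ?thesis .
qed

end
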